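(* Let $(X,d)$ be a u.l.f. metric space, $h\colon X\to\mathbb{R}$ a coarse map, $\beta\in\mathbb{R}$, and let $C$ be a unital C*-subalgebra of $C(\nu X)$, identified with $C(\Omega(C))$ via Gelfand transform. (1) For any extreme $(\sigma_h^\infty,\beta)$-KMS state $\psi$ on $\mathrm{Q}^*_u(X)$ there is $x\in\Omega(C)$ such that $\psi(a)=a(x)$ for all $a\in C$. (2) Suppose there is a $(\sigma_h^\infty,\beta)$-KMS state on $\mathrm{Q}^*_u(X)$ whose restriction to $C$ is faithful. Then for any $x\in\Omega(C)$ there is an extreme $(\sigma_h^\infty,\beta)$-KMS state $\psi$ on $\mathrm{Q}^*_u(X)$ such that $\psi(a)=a(x)$ for all $a\in C$.
   Context: A metric space is u.l.f. if for every $r>0$ the cardinalities of its balls of radius $r$ are uniformly bounded. $\mathrm{C}^*_u(X)$ is the norm closure of the $^*$-algebra of operators $a$ on $\ell_2(X)$ with $\sup\{d(x,y):\langle a\delta_y,\delta_x\rangle\neq0\}<\infty$; $\ell_\infty(X)$ is identified with diagonal operators. $h$ is coarse if for each $r>0$ there is $s>0$ with $d(x,y)<r\Rightarrow|h(x)-h(y)|<s$. $\sigma_{h,t}(a)=e^{it\bar h}ae^{-it\bar h}$, $e^{it\bar h}\delta_x=e^{ith(x)}\delta_x$. $\mathrm{Q}^*_u(X)=\mathrm{C}^*_u(X)/\mathcal{K}(\ell_2(X))$ with quotient map $\pi$, and $\sigma^\infty_{h,t}(\pi(a))=\pi(\sigma_{h,t}(a))$ is the induced flow. A state $\psi$ is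 $(\sigma,\beta)$-KMS if $\psi(a\sigma_{i\beta}(b))=\psi(ba)$ for all $a$ and all analytic $b$ (those for which $t\mapsto\sigma_t(b)$ extends to an entire function); extreme means an extreme point of the set of such states. Higson functions: bounded $f\colon X\to\mathbb{C}$ such that for all $\varepsilon,R>0$ there is finite $F\subseteq X$ with $|f(x)-f(y)|<\varepsilon$ whenever $x,y\notin F$, $d(x,y)<R$; they form a C*-algebra $C_h(X)\subseteq\ell_\infty(X)$ with spectrum $hX$; $\nu X=hX\setminus X$, and $C(\nu X)$ is identified with $C_h(X)/c_0(X)=\pi(C_h(X))\subseteq\mathrm{Q}^*_u(X)$. $\Omega(C)$ is the spectrum of $C$. *)

theory Defs
  imports "HOL-Analysis.Analysis"
begin

type_synonym 'a vec = "'a \<Rightarrow> complex"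
type_synonym 'a op = "'a vec \<Rightarrow> 'a vec"

definition l2 :: "'a vec set" where
  "l2 = {f. (\<lambda>x. (cmod (f x))\<^sup>2) summable_on UNIV}"

definition l2norm :: "'a vec \<Rightarrow> real" where
  "l2norm f = sqrt (infsum (\<lambda>x. (cmod (f x))\<^sup>2) UNIV)"

definition l2inner :: "'a vec \<Rightarrow> 'a vec \<Rightarrow> complex" where
  "l2inner f g = infsum (\<lambda>x. f x * cnj (g x)) UNIV"

definition delta :: "'a \<Rightarrow> 'a vec" where
  "delta y = (\<lambda>x. if x = y then 1 else 0)"

definition bop :: "'a op set" where
  "bop = {T. (\<forall>f\<in>l2. T f \<in> l2) \<and> (\<forall>f. f \<notin> l2 \<longrightarrow> T f = (\<lambda>_. 0))
          \<and> (\<forall>f\<in>l2. \<forall>g\<in>l2. T (\<lambda>x. f x + g x) = (\<lambda>x. T f x + T g x))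
          \<and> (\<forall>f\<in>l2. \<forall>c. T (\<lambda>x. c * f x) = (\<lambda>x. c * T f x))
          \<and> (\<exists>K. \<forall>f\<in>l2. l2norm (T f) \<le> K * l2norm f)}"

definition opnorm :: "'a op \<Rightarrow> real" where
  "opnorm T = Sup ((\<lambda>f. l2norm (T f)) ` {f\<in>l2. l2norm f \<le> 1})"

definition op_add :: "'a op \<Rightarrow> 'a op \<Rightarrow> 'a op" where
  "op_add T S = (\<lambda>f x. T f x + S f x)"

definition op_sub :: "'a op \<Rightarrow> 'a op \<Rightarrow> 'a op" where
  "op_sub T S = (\<lambda>f x. T f x - S f x)"

definition op_scale :: "complex \<Rightarrow> 'a op \<Rightarrow> 'a op" where
  "op_scale c T = (\<lambda>f x. c * T f x)"

definition ident :: "'a op" where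
  "ident = (\<lambda>f. if f \<in> l2 then f else (\<lambda>_. 0))"

definition adj :: "'a op \<Rightarrow> 'a op" where
  "adj T = (THE S. S \<in> bop \<and> (\<forall>f\<in>l2. \<forall>g\<in>l2. l2inner (T f) g = l2inner f (S g)))"

definition mult_op :: "'a vec \<Rightarrow> 'a op" where
  "mult_op g = (\<lambda>f. if f \<in> l2 then (\<lambda>x. g x * f x) else (\<lambda>_. 0))"

definition finite_prop :: "('a::metric_space) op \<Rightarrow> bool" where
  "finite_prop T \<longleftrightarrow> (\<exists>R. \<forall>x y. T (delta y) x \<noteq> 0 \<longrightarrow> dist x y \<le> R)"

definition roe :: "('a::metric_space) op set" where
  "roe = {T\<in>bop. \<forall>\<epsilon>>0. \<exists>S\<in>bop. finite_prop S \<and> opnorm (op_sub T S) < \<epsilon>}"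

definition finite_rank :: "'a op \<Rightarrow> bool" where
  "finite_rank T \<longleftrightarrow> (\<exists>n (u :: nat \<Rightarrow> 'a vec) v. (\<forall>i<n. u i \<in> l2 \<and> v i \<in> l2) \<and>
      (\<forall>f\<in>l2. T f = (\<lambda>x. \<Sum>i<n. l2inner f (v i) * u i x)))"

definition compact_ops :: "'a op set" where
  "compact_ops = {T\<in>bop. \<forall>\<epsilon>>0. \<exists>S\<in>bop. finite_rank S \<and> opnorm (op_sub T S) < \<epsilon>}"

text \<open>Norm of the image in the Calkin-type quotient Q*_u(X) = C*_u(X)/K.\<close>
definition qnorm :: "'a op \<Rightarrow> real" where
  "qnorm T = Inf ((\<lambda>K. opnorm (op_sub T K)) ` compact_ops)"

definition ulf :: "'a::metric_space itself \<Rightarrow> bool" where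
  "ulf _ \<longleftrightarrow> (\<forall>r>0. \<exists>N::nat. \<forall>x::'a. finite (ball x r) \<and> card (ball x r) \<le> N)"

definition coarse :: "('a::metric_space \<Rightarrow> real) \<Rightarrow> bool" where
  "coarse h \<longleftrightarrow> (\<forall>r>0. \<exists>s>0. \<forall>x y. dist x y < r \<longrightarrow> \<bar>h x - h y\<bar> < s)"

definition sigma :: "('a \<Rightarrow> real) \<Rightarrow> real \<Rightarrow> 'a op \<Rightarrow> 'a op" where
  "sigma h t a = mult_op (\<lambda>x. exp (\<i> * of_real (t * h x))) \<circ> a \<circ>
                 mult_op (\<lambda>x. exp (- \<i> * of_real (t * h x)))"

text \<open>F is a lift of an entire extension (into Q*_u(X)) of t \<mapsto> sigma^infty_t(pi b).\<close>
definition analytic_lift :: "('a::metric_space \<Rightarrow> real) \<Rightarrow> 'a op \<Rightarrow> (complex \<Rightarrow> 'a op) \<Rightarrow> bool" where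
  "analytic_lift h b F \<longleftrightarrow> (\<forall>z. F z \<in> roe)
     \<and> (\<forall>t::real. op_sub (F (of_real t)) (sigma h t b) \<in> compact_ops)
     \<and> (\<forall>z. \<exists>G\<in>roe. ((\<lambda>w. qnorm (op_sub (op_scale (1 / (w - z)) (op_sub (F w) (F z))) G))
                        \<longlongrightarrow> 0) (at z))"

text \<open>States on Q*_u(X), represented through their composition with the quotient map.\<close>
definition qstate :: "(('a::metric_space) op \<Rightarrow> complex) \<Rightarrow> bool" where
  "qstate \<psi> \<longleftrightarrow> (\<forall>a\<in>roe. \<forall>b\<in>roe. \<psi> (op_add a b) = \<psi> a + \<psi> b)
     \<and> (\<forall>c. \<forall>a\<in>roe. \<psi> (op_scale c a) = c * \<psi> a)
     \<and> (\<forall>a\<in>roe. \<psi> (adj a \<circ> a) \<in> \<real> \<and> Re (\<psi> (adj a \<circ> a)) \<ge> 0)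
     \<and> \<psi> ident = 1
     \<and> (\<forall>K\<in>compact_ops. \<psi> K = 0)"

definition kms :: "('a::metric_space \<Rightarrow> real) \<Rightarrow> real \<Rightarrow> ('a op \<Rightarrow> complex) \<Rightarrow> bool" where
  "kms h \<beta> \<psi> \<longleftrightarrow> qstate \<psi> \<and>
     (\<forall>a\<in>roe. \<forall>b\<in>roe. \<forall>F. analytic_lift h b F \<longrightarrow> \<psi> (a \<circ> F (\<i> * of_real \<beta>)) = \<psi> (b \<circ> a))"

definition extreme_kms :: "('a::metric_space \<Rightarrow> real) \<Rightarrow> real \<Rightarrow> ('a op \<Rightarrow> complex) \<Rightarrow> bool" where
  "extreme_kms h \<beta> \<psi> \<longleftrightarrow> kms h \<beta> \<psi> \<and>
     (\<forall>\<psi>1 \<psi>2 (s::real). kms h \<beta> \<psi>1 \<and> kms h \<beta> \<psi>2 \<and> 0 < s \<and> s < 1 \<and>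
        (\<forall>a\<in>roe. \<psi> a = of_real s * \<psi>1 a + of_real (1 - s) * \<psi>2 a)
        \<longrightarrow> (\<forall>a\<in>roe. \<psi>1 a = \<psi> a \<and> \<psi>2 a = \<psi> a))"

definition c0 :: "'a vec \<Rightarrow> bool" where
  "c0 f \<longleftrightarrow> (\<forall>\<epsilon>>0. finite {x. cmod (f x) \<ge> \<epsilon>})"

definition higson :: "('a::metric_space) vec \<Rightarrow> bool" where
  "higson f \<longleftrightarrow> bounded (range f) \<and>
     (\<forall>\<epsilon>>0. \<forall>R>0. \<exists>F. finite F \<and>
        (\<forall>x y. x \<notin> F \<and> y \<notin> F \<and> dist x y < R \<longrightarrow> cmod (f x - f y) < \<epsilon>))"

text \<open>A unital C*-subalgebra C of C(nu X) = C_h(X)/c0(X), represented by its full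
  preimage Cl in C_h(X) (so c0(X) is contained in Cl).\<close>
definition unital_sub_Cnu :: "('a::metric_space) vec set \<Rightarrow> bool" where
  "unital_sub_Cnu Cl \<longleftrightarrow> (\<forall>f\<in>Cl. higson f) \<and> (\<forall>f. c0 f \<longrightarrow> f \<in> Cl)
     \<and> (\<lambda>_. 1) \<in> Cl
     \<and> (\<forall>f\<in>Cl. \<forall>g\<in>Cl. (\<lambda>x. f x + g x) \<in> Cl \<and> (\<lambda>x. f x * g x) \<in> Cl)
     \<and> (\<forall>c. \<forall>f\<in>Cl. (\<lambda>x. c * f x) \<in> Cl)
     \<and> (\<forall>f\<in>Cl. (\<lambda>x. cnj (f x)) \<in> Cl)
     \<and> (\<forall>f. bounded (range f) \<and> (\<forall>\<epsilon>>0. \<exists>g\<in>Cl. \<forall>x. cmod (f x - g x) < \<epsilon>) \<longrightarrow> f \<in> Cl)"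

text \<open>Points of Omega(C): unital characters of C, i.e. of Cl vanishing on c0(X).\<close>
definition character :: "'a vec set \<Rightarrow> ('a vec \<Rightarrow> complex) \<Rightarrow> bool" where
  "character Cl chr \<longleftrightarrow> (\<forall>f\<in>Cl. c0 f \<longrightarrow> chr f = 0)
     \<and> (\<forall>f\<in>Cl. \<forall>g\<in>Cl. chr (\<lambda>x. f x + g x) = chr f + chr g \<and> chr (\<lambda>x. f x * g x) = chr f * chr g)
     \<and> (\<forall>c. \<forall>f\<in>Cl. chr (\<lambda>x. c * f x) = c * chr f)
     \<and> chr (\<lambda>_. 1) = 1"

definition faithful_on :: "'a vec set \<Rightarrow> ('a op \<Rightarrow> complex) \<Rightarrow> bool" where
  "faithful_on Cl \<psi> \<longleftrightarrow>
     (\<forall>f\<in>Cl. \<psi> (adj (mult_op f) \<circ> mult_op f) = 0 \<longrightarrow> mult_op f \<in> compact_ops)"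

end

(* Higson functions commute with the Roe algebra modulo compact operators, so a KMS state psi on the
   quotient can be reweighted: psi(g^2 .) / psi(g^2) is again KMS for every real Higson function g.
   If psi is extreme, splitting 1 = w + (1 - w) with w a rescaled Higson function gives
   psi(f a) = psi(f) psi(a), so psi is a character on C.

   Conversely, given a character x of C, a KMS state that is faithful on C can be reweighted so as to
   live where finitely many elements of the kernel of x are small.  By weak-* compactness some KMS
   state restricts to evaluation at x.  Since evaluation at x is a pure state of C, the KMS states
   with this restriction form a compact face, and a Krein-Milman argument yields an extreme point.

   Compactness needs a bound on states that are only assumed to be positive on the elements a* a;
   it comes from the square root of 1 - t a* a inside the Roe algebra. *)
theory Submission
  imports Defs
begin

subsection \<open>Square summable functions\<close>

text \<open>Positivity of a state is available only on elements \<open>adj a \<circ> a\<close> with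
  \<open>a\<close> in the Roe algebra, and this shapes both halves. A weight has to be the square of
  a Higson function \<open>g\<close>: one factor moves across modulo compacts, and
  \<open>mult_op g \<circ> (adj a \<circ> a) \<circ> mult_op g\<close> is
  \<open>adj c \<circ> c\<close> for \<open>c = a \<circ> mult_op g\<close>. Hence the two
  complementary weights are kept between 1/4 and 3/4, where the square root is Lipschitz and
  preserves the Higson property. The KMS identity survives because the weight is first absorbed into
  \<open>a\<close> and then commuted past \<open>b\<close>. Purity of evaluation enters through
  squares: by Cauchy-Schwarz a state restricts to the character once it vanishes on
  \<open>adj (mult_op f) \<circ> mult_op f\<close> for every f in the kernel, and the vanishing of a
  nonnegative quantity passes to both members of a convex decomposition. States are functions on all
  operators; fixing the value 0 outside \<open>roe\<close> turns the KMS states into a closed subset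
  of a product of discs, where Tychonoff applies.\<close>

lemma sum_sq_le_iff_L2_set:
  assumes "B \<ge> 0"
  shows "(\<Sum>x\<in>F. (cmod (f x))\<^sup>2) \<le> B\<^sup>2 \<longleftrightarrow> L2_set (\<lambda>x. cmod (f x)) F \<le> B"
  unfolding L2_set_def using assms
  by (metis abs_of_nonneg real_sqrt_abs real_sqrt_le_iff)

text \<open>The norm is a supremum over finite partial sums. Estimates can therefore be made on
  finite sets, where the Minkowski and Cauchy-Schwarz inequalities for \<open>L2_set\<close> are at
  hand.\<close>

lemma l2_bound:
  assumes "\<And>F. finite F \<Longrightarrow> L2_set (\<lambda>x. cmod (f x)) F \<le> B"
  shows "f \<in> l2" "l2norm f \<le> B"
proof -
  have B: "B \<ge> 0" using assms[of "{}"] by simp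
  have s: "(\<Sum>x\<in>F. (cmod (f x))\<^sup>2) \<le> B\<^sup>2" if "finite F" for F
    using assms[OF that] sum_sq_le_iff_L2_set[OF B] by blast
  have sm: "(\<lambda>x. (cmod (f x))\<^sup>2) summable_on UNIV"
    by (rule nonneg_bdd_above_summable_on) (auto intro!: bdd_aboveI2 s)
  then show "f \<in> l2" by (simp add: l2_def)
  have "infsum (\<lambda>x. (cmod (f x))\<^sup>2) UNIV \<le> B\<^sup>2"
    by (rule infsum_le_finite_sums[OF sm]) (auto intro: s)
  then show "l2norm f \<le> B"
    unfolding l2norm_def using B by (simp add: real_le_lsqrt infsum_nonneg)
qed

lemma L2_set_le_l2norm:
  assumes "f \<in> l2"
  shows "L2_set (\<lambda>x. cmod (f x)) F \<le> l2norm f"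
proof (cases "finite F")
  case True
  have "(\<Sum>x\<in>F. (cmod (f x))\<^sup>2) \<le> infsum (\<lambda>x. (cmod (f x))\<^sup>2) UNIV"
    by (rule finite_sum_le_infsum) (use assms True in \<open>auto simp: l2_def\<close>)
  then show ?thesis unfolding L2_set_def l2norm_def by simp
qed (simp add: l2norm_def infsum_nonneg)

lemma l2norm_nonneg [simp]: "l2norm f \<ge> 0"
  by (simp add: l2norm_def infsum_nonneg)

lemma cmod_le_l2norm: "f \<in> l2 \<Longrightarrow> cmod (f x) \<le> l2norm f"
  using L2_set_le_l2norm[of f "{x}"] by simp

lemma l2_add:
  assumes "f \<in> l2" "g \<in> l2"
  shows "(\<lambda>x. f x + g x) \<in> l2" "l2norm (\<lambda>x. f x + g x) \<le> l2norm f + l2norm g"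
proof -
  have "L2_set (\<lambda>x. cmod (f x + g x)) F \<le> l2norm f + l2norm g" for F
  proof -
    have "L2_set (\<lambda>x. cmod (f x + g x)) F \<le> L2_set (\<lambda>x. cmod (f x) + cmod (g x)) F"
      by (rule L2_set_mono) (auto intro: norm_triangle_ineq)
    also have "\<dots> \<le> L2_set (\<lambda>x. cmod (f x)) F + L2_set (\<lambda>x. cmod (g x)) F"
      by (rule L2_set_triangle_ineq)
    finally show ?thesis using L2_set_le_l2norm[OF assms(1), of F] L2_set_le_l2norm[OF assms(2), of F]
      by linarith
  qed
  then show "(\<lambda>x. f x + g x) \<in> l2" "l2norm (\<lambda>x. f x + g x) \<le> l2norm f + l2norm g"
    by (auto intro: l2_bound)
qed

lemma l2_dominated:
  assumes "f \<in> l2" "C \<ge> 0" "\<And>x. cmod (g x) \<le> C * cmod (f x)"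
  shows "g \<in> l2" "l2norm g \<le> C * l2norm f"
proof -
  have "L2_set (\<lambda>x. cmod (g x)) F \<le> C * l2norm f" for F
  proof -
    have "L2_set (\<lambda>x. cmod (g x)) F \<le> L2_set (\<lambda>x. C * cmod (f x)) F"
      by (rule L2_set_mono) (use assms in auto)
    also have "\<dots> = C * L2_set (\<lambda>x. cmod (f x)) F"
      using assms by (simp add: L2_set_right_distrib)
    finally show ?thesis using mult_left_mono[OF L2_set_le_l2norm[OF assms(1), of F] assms(2)]
      by linarith
  qed
  then show "g \<in> l2" "l2norm g \<le> C * l2norm f"
    by (auto intro: l2_bound)
qed

lemma l2_scale: "f \<in> l2 \<Longrightarrow> (\<lambda>x. c * f x) \<in> l2"
  by (rule l2_dominated(1)[of f "cmod c"]) (auto simp: norm_mult)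

lemma l2norm_scale:
  assumes "f \<in> l2" shows "l2norm (\<lambda>x. c * f x) = cmod c * l2norm f"
  unfolding l2norm_def norm_mult power_mult_distrib infsum_cmult_right'
  by (simp add: real_sqrt_mult)

lemma l2_zero [simp]: "(\<lambda>_. 0) \<in> l2" "l2norm (\<lambda>_. 0) = 0"
  by (auto simp: l2_def l2norm_def)

lemma l2_diff:
  assumes "f \<in> l2" "g \<in> l2"
  shows "(\<lambda>x. f x - g x) \<in> l2" "l2norm (\<lambda>x. f x - g x) \<le> l2norm f + l2norm g"
  using l2_add[OF assms(1) l2_scale[OF assms(2), of "-1"]] l2norm_scale[OF assms(2), of "-1"]
  by auto

lemma l2_sum: "(\<And>i. i \<in> I \<Longrightarrow> u i \<in> l2) \<Longrightarrow> (\<lambda>x. \<Sum>i\<in>I. u i x) \<in> l2"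
  by (induction I rule: infinite_finite_induct) (auto intro: l2_add)

lemma l2_finite_support:
  assumes "finite F" "\<And>x. x \<notin> F \<Longrightarrow> f x = 0" shows "f \<in> l2"
proof -
  have "(\<lambda>x. (cmod (f x))\<^sup>2) summable_on UNIV"
    by (rule finite_nonzero_values_imp_summable_on, rule finite_subset[OF _ assms(1)])
       (use assms(2) in auto)
  then show ?thesis by (simp add: l2_def)
qed

lemma l2_delta [simp]: "delta x \<in> l2"
  by (rule l2_finite_support[of "{x}"]) (auto simp: delta_def)

lemma l2norm_delta [simp]: "l2norm (delta x) = 1"
proof -
  have "infsum (\<lambda>y. (cmod (delta x y))\<^sup>2) UNIV = infsum (\<lambda>y. 1) {x}"
    by (rule infsum_cong_neutral) (auto simp: delta_def)
  then show ?thesis by (simp add: l2norm_def)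
qed

lemma l2_truncate:
  assumes "f \<in> l2" shows "(\<lambda>x. if x \<in> F then f x else 0) \<in> l2"
  using l2_dominated(1)[OF assms, of 1 "\<lambda>x. if x \<in> F then f x else 0"] by auto

text \<open>The squared norm of the remainder is the tail of a convergent sum; this is the density
  of finitely supported vectors.\<close>

lemma l2_truncate_approx:
  assumes "f \<in> l2" "\<epsilon> > 0"
  shows "\<exists>F. finite F \<and> l2norm (\<lambda>x. f x - (if x \<in> F then f x else 0)) < \<epsilon>"
proof -
  let ?q = "\<lambda>x. (cmod (f x))\<^sup>2"
  have s: "?q summable_on UNIV" using assms by (simp add: l2_def)
  have "(sum ?q \<longlongrightarrow> infsum ?q UNIV) (finite_subsets_at_top UNIV)"
    by (rule infsum_tendsto[OF s])
  then have "\<forall>\<^sub>F F in finite_subsets_at_top UNIV. dist (sum ?q F) (infsum ?q UNIV) < \<epsilon>\<^sup>2"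
    by (rule tendstoD) (use assms(2) in auto)
  then obtain F where F: "finite F" "dist (sum ?q F) (infsum ?q UNIV) < \<epsilon>\<^sup>2"
    by (auto simp: eventually_finite_subsets_at_top)
  have "infsum ?q UNIV = infsum ?q F + infsum ?q (- F)"
    by (subst infsum_Un_disjoint[symmetric])
       (auto intro: summable_on_subset_banach[OF s] simp: Un_commute)
  then have "infsum ?q (- F) < \<epsilon>\<^sup>2"
    using F by (auto simp: dist_real_def)
  moreover have "infsum (\<lambda>x. (cmod (f x - (if x \<in> F then f x else 0)))\<^sup>2) UNIV = infsum ?q (- F)"
    by (rule infsum_cong_neutral) auto
  ultimately have "l2norm (\<lambda>x. f x - (if x \<in> F then f x else 0)) < \<epsilon>"
    unfolding l2norm_def using assms(2) by (auto intro!: real_less_lsqrt)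
  then show ?thesis using F by blast
qed

subsection \<open>The inner product\<close>

lemma l2inner_bound:
  assumes "f \<in> l2" "g \<in> l2"
  shows "(\<lambda>x. norm (f x * cnj (g x))) summable_on UNIV" "cmod (l2inner f g) \<le> l2norm f * l2norm g"
proof -
  have b: "(\<Sum>x\<in>F. norm (f x * cnj (g x))) \<le> l2norm f * l2norm g" for F
  proof -
    have "(\<Sum>x\<in>F. norm (f x * cnj (g x))) = (\<Sum>x\<in>F. \<bar>cmod (f x)\<bar> * \<bar>cmod (g x)\<bar>)"
      by (simp add: norm_mult)
    also have "\<dots> \<le> L2_set (\<lambda>x. cmod (f x)) F * L2_set (\<lambda>x. cmod (g x)) F"
      by (rule L2_set_mult_ineq)
    also have "\<dots> \<le> l2norm f * l2norm g"
      by (intro mult_mono L2_set_le_l2norm assms) auto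
    finally show ?thesis .
  qed
  show s: "(\<lambda>x. norm (f x * cnj (g x))) summable_on UNIV"
    unfolding abs_summable_iff_bdd_above by (auto intro!: bdd_aboveI2 b)
  have "cmod (l2inner f g) \<le> infsum (\<lambda>x. norm (f x * cnj (g x))) UNIV"
    unfolding l2inner_def by (rule norm_infsum_bound[OF s])
  also have "\<dots> \<le> l2norm f * l2norm g"
    by (rule infsum_le_finite_sums) (use s b in auto)
  finally show "cmod (l2inner f g) \<le> l2norm f * l2norm g" .
qed

lemma l2inner_summable: "f \<in> l2 \<Longrightarrow> g \<in> l2 \<Longrightarrow> (\<lambda>x. f x * cnj (g x)) summable_on UNIV"
  by (rule Infinite_Sum.abs_summable_summable) (rule l2inner_bound(1))

lemma l2inner_add_left:
  "f \<in> l2 \<Longrightarrow> f' \<in> l2 \<Longrightarrow> g \<in> l2 \<Longrightarrow> l2inner (\<lambda>x. f x + f' x) g = l2inner f g + l2inner f' g"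
  unfolding l2inner_def by (subst infsum_add[symmetric]) (auto simp: l2inner_summable algebra_simps)

lemma l2inner_scale_left: "l2inner (\<lambda>x. c * f x) g = c * l2inner f g"
  unfolding l2inner_def by (subst infsum_cmult_right'[symmetric]) (simp add: mult.assoc)

lemma l2inner_commute: "l2inner f g = cnj (l2inner g f)"
  unfolding l2inner_def infsum_cnj[symmetric] by (simp add: mult.commute)

lemma l2inner_add_right:
  "f \<in> l2 \<Longrightarrow> g \<in> l2 \<Longrightarrow> g' \<in> l2 \<Longrightarrow> l2inner f (\<lambda>x. g x + g' x) = l2inner f g + l2inner f g'"
  by (subst (1 2 3) l2inner_commute) (simp add: l2inner_add_left)

lemma l2inner_scale_right: "l2inner f (\<lambda>x. c * g x) = cnj c * l2inner f g"
  by (subst (1 2) l2inner_commute) (simp add: l2inner_scale_left)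

lemma l2inner_zero_left [simp]: "l2inner (\<lambda>_. 0) g = 0"
  by (simp add: l2inner_def)

lemma l2inner_sum_left:
  "(\<And>i. i \<in> I \<Longrightarrow> u i \<in> l2) \<Longrightarrow> g \<in> l2 \<Longrightarrow>
    l2inner (\<lambda>x. \<Sum>i\<in>I. u i x) g = (\<Sum>i\<in>I. l2inner (u i) g)"
  by (induction I rule: infinite_finite_induct) (auto simp: l2inner_add_left l2_sum)

lemma l2inner_finite_support:
  assumes "finite F" "\<And>x. x \<notin> F \<Longrightarrow> f x = 0 \<or> g x = 0"
  shows "l2inner f g = (\<Sum>x\<in>F. f x * cnj (g x))"
proof -
  have "l2inner f g = infsum (\<lambda>x. f x * cnj (g x)) F"
    unfolding l2inner_def by (rule infsum_cong_neutral) (use assms in auto)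
  then show ?thesis using assms by simp
qed

lemma l2inner_delta_right [simp]: "l2inner f (delta x) = f x"
  by (subst l2inner_finite_support[of "{x}"]) (auto simp: delta_def)

lemma l2inner_delta_left [simp]: "l2inner (delta x) f = cnj (f x)"
  by (subst l2inner_commute) simp

subsection \<open>Bounded operators\<close>

lemma bop_l2: "T \<in> bop \<Longrightarrow> f \<in> l2 \<Longrightarrow> T f \<in> l2"
  and bop_not_l2: "T \<in> bop \<Longrightarrow> f \<notin> l2 \<Longrightarrow> T f = (\<lambda>_. 0)"
  and bop_add: "T \<in> bop \<Longrightarrow> f \<in> l2 \<Longrightarrow> g \<in> l2 \<Longrightarrow> T (\<lambda>x. f x + g x) = (\<lambda>x. T f x + T g x)"
  and bop_scale: "T \<in> bop \<Longrightarrow> f \<in> l2 \<Longrightarrow> T (\<lambda>x. c * f x) = (\<lambda>x. c * T f x)"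
  by (auto simp: bop_def)

lemma bopI:
  assumes "\<And>f. f \<in> l2 \<Longrightarrow> T f \<in> l2" "\<And>f. f \<notin> l2 \<Longrightarrow> T f = (\<lambda>_. 0)"
    and "\<And>f g. f \<in> l2 \<Longrightarrow> g \<in> l2 \<Longrightarrow> T (\<lambda>x. f x + g x) = (\<lambda>x. T f x + T g x)"
    and "\<And>f c. f \<in> l2 \<Longrightarrow> T (\<lambda>x. c * f x) = (\<lambda>x. c * T f x)"
    and "\<And>f. f \<in> l2 \<Longrightarrow> l2norm (T f) \<le> K * l2norm f"
  shows "T \<in> bop"
  using assms unfolding bop_def by blast

lemma bop_zero: "T \<in> bop \<Longrightarrow> T (\<lambda>_. 0) = (\<lambda>_. 0)"
  using bop_scale[of T "\<lambda>_. 0" 0] by simp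

lemma bop_diff:
  assumes "T \<in> bop" "f \<in> l2" "g \<in> l2" shows "T (\<lambda>x. f x - g x) = (\<lambda>x. T f x - T g x)"
proof -
  have "T (\<lambda>x. f x + (-1) * g x) = (\<lambda>x. T f x + (-1) * T g x)"
    unfolding bop_add[OF assms(1,2) l2_scale[OF assms(3)]] bop_scale[OF assms(1,3)] ..
  then show ?thesis by simp
qed

lemma bop_sum:
  assumes "T \<in> bop" "\<And>i. i \<in> I \<Longrightarrow> u i \<in> l2"
  shows "T (\<lambda>x. \<Sum>i\<in>I. u i x) = (\<lambda>x. \<Sum>i\<in>I. T (u i) x)"
  using assms(2)
  by (induction I rule: infinite_finite_induct) (auto simp: bop_zero[OF assms(1)] bop_add[OF assms(1)] l2_sum)

lemma opnorm_bdd: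
  assumes "T \<in> bop" shows "bdd_above ((\<lambda>f. l2norm (T f)) ` {f\<in>l2. l2norm f \<le> 1})"
proof -
  obtain K where K: "\<forall>f\<in>l2. l2norm (T f) \<le> K * l2norm f" using assms by (auto simp: bop_def)
  have "l2norm (T f) \<le> \<bar>K\<bar>" if "f \<in> l2" "l2norm f \<le> 1" for f
  proof -
    have "l2norm (T f) \<le> \<bar>K\<bar> * l2norm f"
      using K that mult_right_mono[of K "\<bar>K\<bar>" "l2norm f"] by fastforce
    also have "\<dots> \<le> \<bar>K\<bar> * 1" using that by (intro mult_left_mono) auto
    finally show ?thesis by simp
  qed
  then show ?thesis by (auto intro!: bdd_aboveI2)
qed

lemma opnorm_nonneg:
  assumes "T \<in> bop" shows "opnorm T \<ge> 0"
proof -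
  have "l2norm (T (\<lambda>_. 0)) \<le> opnorm T"
    unfolding opnorm_def by (rule cSUP_upper) (auto intro: opnorm_bdd[OF assms])
  then show ?thesis using bop_zero[OF assms] by simp
qed

lemma l2norm_eq_0: "f \<in> l2 \<Longrightarrow> l2norm f = 0 \<Longrightarrow> f = (\<lambda>_. 0)"
  using cmod_le_l2norm by fastforce

lemma opnorm_bound:
  assumes "T \<in> bop" "f \<in> l2" shows "l2norm (T f) \<le> opnorm T * l2norm f"
proof (cases "l2norm f = 0")
  case True
  then show ?thesis using l2norm_eq_0[OF assms(2)] bop_zero[OF assms(1)] by simp
next
  case False
  let ?n = "l2norm f"
  have n: "?n > 0" using False l2norm_nonneg[of f] by linarith
  let ?g = "\<lambda>x. of_real (1 / ?n) * f x"
  have g: "?g \<in> l2" "l2norm ?g \<le> 1"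
    using assms n by (auto intro: l2_scale simp: l2norm_scale simp del: of_real_divide)
  have "l2norm (T ?g) \<le> opnorm T"
    unfolding opnorm_def by (rule cSUP_upper) (use g in \<open>auto intro: opnorm_bdd[OF assms(1)]\<close>)
  moreover have "l2norm (T ?g) = 1 / ?n * l2norm (T f)"
    unfolding bop_scale[OF assms] using n by (subst l2norm_scale[OF bop_l2[OF assms]]) (auto simp: norm_divide)
  ultimately have "1 / ?n * l2norm (T f) \<le> opnorm T" by simp
  then show ?thesis using n by (simp add: field_simps)
qed

lemma opnorm_le:
  assumes "K \<ge> 0" "\<And>f. f \<in> l2 \<Longrightarrow> l2norm (T f) \<le> K * l2norm f"
  shows "opnorm T \<le> K"
  unfolding opnorm_def
proof (rule cSUP_least)
  fix f :: "'a vec" assume f: "f \<in> {f \<in> l2. l2norm f \<le> 1}"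
  then have "l2norm (T f) \<le> K * l2norm f" using assms by auto
  also have "\<dots> \<le> K * 1" using f assms by (intro mult_left_mono) auto
  finally show "l2norm (T f) \<le> K" by simp
next
  have "(\<lambda>_. 0) \<in> {f \<in> l2. l2norm f \<le> 1}" by simp
  then show "{f \<in> l2. l2norm f \<le> 1} \<noteq> {}" by blast
qed

text \<open>Members of \<open>bop\<close> are pinned to 0 off \<open>l2\<close>, so HOL equality of
  functions reduces to equality on \<open>l2\<close>.\<close>

lemma bop_eqI:
  assumes "T \<in> bop" "S \<in> bop" "\<And>f. f \<in> l2 \<Longrightarrow> T f = S f" shows "T = S"
  using assms bop_not_l2 by (metis ext)

lemma bop_op_add:
  assumes "T \<in> bop" "S \<in> bop"
  shows "op_add T S \<in> bop" "opnorm (op_add T S) \<le> opnorm T + opnorm S"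
proof -
  have b: "l2norm (op_add T S f) \<le> (opnorm T + opnorm S) * l2norm f" if "f \<in> l2" for f
    using l2_add(2)[OF bop_l2[OF assms(1) that] bop_l2[OF assms(2) that]]
      opnorm_bound[OF assms(1) that] opnorm_bound[OF assms(2) that]
    by (simp add: op_add_def distrib_right)
  show "op_add T S \<in> bop"
    by (rule bopI[OF _ _ _ _ b])
       (auto simp: op_add_def bop_l2 bop_not_l2 bop_add bop_scale assms l2_add algebra_simps)
  show "opnorm (op_add T S) \<le> opnorm T + opnorm S"
    by (rule opnorm_le) (use b assms opnorm_nonneg in \<open>auto intro: add_nonneg_nonneg\<close>)
qed

lemma bop_op_scale:
  assumes "T \<in> bop"
  shows "op_scale c T \<in> bop" "opnorm (op_scale c T) \<le> cmod c * opnorm T"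
proof -
  have b: "l2norm (op_scale c T f) \<le> (cmod c * opnorm T) * l2norm f" if "f \<in> l2" for f
    using l2norm_scale[OF bop_l2[OF assms(1) that], of c]
      mult_left_mono[OF opnorm_bound[OF assms(1) that], of "cmod c"]
    by (simp add: op_scale_def mult.assoc)
  show "op_scale c T \<in> bop"
    by (rule bopI[OF _ _ _ _ b])
       (auto simp: op_scale_def bop_l2 bop_not_l2 bop_add bop_scale assms l2_scale algebra_simps)
  show "opnorm (op_scale c T) \<le> cmod c * opnorm T"
    by (rule opnorm_le[OF mult_nonneg_nonneg]) (use b opnorm_nonneg assms in auto)
qed

lemma op_sub_conv: "op_sub T S = op_add T (op_scale (-1) S)"
  by (auto simp: op_sub_def op_add_def op_scale_def)

lemma bop_op_sub:
  assumes "T \<in> bop" "S \<in> bop"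
  shows "op_sub T S \<in> bop" "opnorm (op_sub T S) \<le> opnorm T + opnorm S"
  unfolding op_sub_conv
  using bop_op_add[OF assms(1) bop_op_scale(1)[OF assms(2)], of "-1"] bop_op_scale(2)[OF assms(2), of "-1"]
  by auto

lemma bop_comp:
  assumes "T \<in> bop" "S \<in> bop"
  shows "T \<circ> S \<in> bop" "opnorm (T \<circ> S) \<le> opnorm T * opnorm S"
proof -
  have b: "l2norm ((T \<circ> S) f) \<le> (opnorm T * opnorm S) * l2norm f" if "f \<in> l2" for f
    using opnorm_bound[OF assms(1) bop_l2[OF assms(2) that]]
      mult_left_mono[OF opnorm_bound[OF assms(2) that] opnorm_nonneg[OF assms(1)]]
    by (simp add: mult.assoc)
  show "T \<circ> S \<in> bop"
    by (rule bopI[OF _ _ _ _ b])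
       (auto simp: bop_l2 bop_not_l2 bop_zero bop_add bop_scale assms)
  show "opnorm (T \<circ> S) \<le> opnorm T * opnorm S"
    by (rule opnorm_le[OF mult_nonneg_nonneg]) (use b opnorm_nonneg assms in auto)
qed

lemma comp_op_add_left: "op_add T S \<circ> R = op_add (T \<circ> R) (S \<circ> R)"
  and comp_op_sub_left: "op_sub T S \<circ> R = op_sub (T \<circ> R) (S \<circ> R)"
  and comp_op_scale_left: "op_scale c T \<circ> R = op_scale c (T \<circ> R)"
  by (auto simp: op_add_def op_sub_def op_scale_def)

lemma comp_op_add_right:
  assumes "T \<in> bop" "R \<in> bop" "S \<in> bop"
  shows "T \<circ> op_add R S = op_add (T \<circ> R) (T \<circ> S)"
  by (rule bop_eqI) (auto simp: assms bop_comp bop_op_add, auto simp: op_add_def bop_add bop_l2 assms)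

lemma comp_op_scale_right:
  assumes "T \<in> bop" "R \<in> bop"
  shows "T \<circ> op_scale c R = op_scale c (T \<circ> R)"
  by (rule bop_eqI) (auto simp: assms bop_comp bop_op_scale, auto simp: op_scale_def bop_scale bop_l2 assms)

lemma comp_op_sub_right:
  assumes "T \<in> bop" "R \<in> bop" "S \<in> bop"
  shows "T \<circ> op_sub R S = op_sub (T \<circ> R) (T \<circ> S)"
  unfolding op_sub_conv by (simp add: assms comp_op_add_right comp_op_scale_right bop_op_scale)

lemma opnorm_op_sub_commute: "opnorm (op_sub S T) = opnorm (op_sub T S)"
  unfolding opnorm_def op_sub_def l2norm_def by (simp add: norm_minus_commute)

lemma opnorm_op_sub_triangle:
  assumes "R \<in> bop" "S \<in> bop" "T \<in> bop"
  shows "opnorm (op_sub R T) \<le> opnorm (op_sub R S) + opnorm (op_sub S T)"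
proof -
  have "op_sub R T = op_add (op_sub R S) (op_sub S T)"
    by (auto simp: op_sub_def op_add_def)
  then show ?thesis using bop_op_add(2) bop_op_sub(1) assms by metis
qed

subsection \<open>Multiplication operators\<close>

lemma mult_op_bop_bound:
  assumes "\<And>x. cmod (g x) \<le> M"
  shows "mult_op g \<in> bop" "opnorm (mult_op g) \<le> M"
proof -
  have M: "M \<ge> 0" using assms norm_ge_zero order_trans by blast
  have l: "(\<lambda>x. g x * f x) \<in> l2" "l2norm (\<lambda>x. g x * f x) \<le> M * l2norm f" if "f \<in> l2" for f
    by (rule l2_dominated[OF that M], simp add: norm_mult mult_right_mono assms)+
  show "mult_op g \<in> bop"
    by (rule bopI[where K=M]) (auto simp: mult_op_def l l2_add l2_scale distrib_left mult.left_commute)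
  show "opnorm (mult_op g) \<le> M"
    by (rule opnorm_le[OF M]) (simp add: mult_op_def l)
qed

lemma mult_op_bop: "bounded (range g) \<Longrightarrow> mult_op g \<in> bop"
  by (auto simp: bounded_iff intro: mult_op_bop_bound(1))

lemma ident_eq_mult_op: "ident = mult_op (\<lambda>_. 1)"
  by (auto simp: ident_def mult_op_def)

lemma ident_bop: "ident \<in> bop"
  unfolding ident_eq_mult_op by (rule mult_op_bop) auto

lemma comp_ident:
  assumes "T \<in> bop" shows "T \<circ> ident = T" "ident \<circ> T = T"
  by (rule bop_eqI; simp add: assms bop_comp ident_bop; simp add: ident_def bop_l2[OF assms])+

lemma mult_op_comp:
  assumes "bounded (range g)" shows "mult_op f \<circ> mult_op g = mult_op (\<lambda>x. f x * g x)"
proof -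
  have "(\<lambda>x. g x * v x) \<in> l2" if "v \<in> l2" for v
    using bop_l2[OF mult_op_bop[OF assms] that] that by (simp add: mult_op_def)
  then show ?thesis by (auto simp: mult_op_def fun_eq_iff)
qed

lemma op_add_mult_op: "op_add (mult_op f) (mult_op g) = mult_op (\<lambda>x. f x + g x)"
  and op_sub_mult_op: "op_sub (mult_op f) (mult_op g) = mult_op (\<lambda>x. f x - g x)"
  and op_scale_mult_op: "op_scale c (mult_op g) = mult_op (\<lambda>x. c * g x)"
  by (auto simp: op_add_def op_sub_def op_scale_def mult_op_def fun_eq_iff algebra_simps)

subsection \<open>Adjoints\<close>

lemma l2norm_finite_support:
  assumes "finite F" "\<And>x. x \<notin> F \<Longrightarrow> f x = 0"
  shows "l2norm f = L2_set (\<lambda>x. cmod (f x)) F"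
proof -
  have "infsum (\<lambda>x. (cmod (f x))\<^sup>2) UNIV = infsum (\<lambda>x. (cmod (f x))\<^sup>2) F"
    by (rule infsum_cong_neutral) (use assms in auto)
  then show ?thesis using assms by (simp add: l2norm_def L2_set_def)
qed

lemma bop_finite_support:
  assumes "T \<in> bop" "finite F" "\<And>x. x \<notin> F \<Longrightarrow> f x = 0"
  shows "T f = (\<lambda>y. \<Sum>x\<in>F. f x * T (delta x) y)"
proof -
  have "f = (\<lambda>y. \<Sum>x\<in>F. f x * delta x y)"
    using assms(2,3) by (auto simp: delta_def fun_eq_iff if_distrib cong: if_cong)
  then have "T f = T (\<lambda>y. \<Sum>x\<in>F. f x * delta x y)" by simp
  also have "\<dots> = (\<lambda>y. \<Sum>x\<in>F. f x * T (delta x) y)"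
    by (simp add: bop_sum[OF assms(1)] l2_scale bop_scale[OF assms(1)])
  finally show ?thesis .
qed

text \<open>An explicit witness for the definite description in \<^const>\<open>adj\<close>.\<close>
definition adjm :: "'a op \<Rightarrow> 'a op" where
  "adjm T = (\<lambda>g. if g \<in> l2 then (\<lambda>x. l2inner g (T (delta x))) else (\<lambda>_. 0))"

text \<open>Duality: the coefficient vector \<open>c\<close>, cut off to a finite set, is fed back
  into \<open>T\<close>. If A is its norm, \<open>l2inner (T v) g\<close> equals A^2 and is at most
  \<open>opnorm T * A * l2norm g\<close>; cancelling one A bounds the partial norm.\<close>

lemma adjm_bop:
  assumes "T \<in> bop"
  shows "adjm T \<in> bop" "opnorm (adjm T) \<le> opnorm T"
proof -
  have b: "L2_set (\<lambda>x. cmod (adjm T g x)) F \<le> opnorm T * l2norm g" if g: "g \<in> l2" and F: "finite F" for g F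
  proof -
    define c where "c = (\<lambda>x. l2inner g (T (delta x)))"
    define v where "v = (\<lambda>x. if x \<in> F then c x else 0)"
    define A where "A = L2_set (\<lambda>x. cmod (c x)) F"
    have v: "v \<in> l2" by (rule l2_finite_support[OF F]) (auto simp: v_def)
    have nv: "l2norm v = A"
      unfolding A_def by (subst l2norm_finite_support[OF F]) (auto simp: v_def intro!: L2_set_cong)
    have "l2inner (T v) g = (\<Sum>x\<in>F. v x * l2inner (T (delta x)) g)"
      by (subst bop_finite_support[OF assms F])
         (auto simp: v_def l2inner_sum_left l2inner_scale_left bop_l2[OF assms] g l2_scale)
    also have "\<dots> = (\<Sum>x\<in>F. of_real ((cmod (c x))\<^sup>2))"
      by (rule sum.cong[OF refl], subst l2inner_commute)
         (simp add: v_def c_def complex_norm_square[symmetric])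
    also have "\<dots> = of_real (A\<^sup>2)"
      by (simp add: A_def L2_set_def sum_nonneg)
    finally have "cmod (l2inner (T v) g) = A\<^sup>2" by (simp add: norm_power)
    moreover have "cmod (l2inner (T v) g) \<le> (opnorm T * A) * l2norm g"
      using l2inner_bound(2)[OF bop_l2[OF assms v] g] opnorm_bound[OF assms v]
        mult_right_mono[OF opnorm_bound[OF assms v] l2norm_nonneg[of g]] nv by simp
    ultimately have "A * A \<le> (opnorm T * l2norm g) * A" by (simp add: power2_eq_square mult_ac)
    moreover have "A = 0 \<or> A > 0" by (simp add: A_def less_le)
    ultimately have "A \<le> opnorm T * l2norm g"
      using opnorm_nonneg[OF assms] mult_right_le_imp_le by auto
    then show ?thesis using g by (simp add: A_def c_def adjm_def)
  qed
  have l: "adjm T g \<in> l2" "l2norm (adjm T g) \<le> opnorm T * l2norm g" if "g \<in> l2" for g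
    using l2_bound[OF b[OF that]] by auto
  show "adjm T \<in> bop"
    by (rule bopI[OF _ _ _ _ l(2)])
       (auto simp: l, auto simp: adjm_def l2_add l2_scale l2inner_add_left l2inner_scale_left bop_l2 assms)
  show "opnorm (adjm T) \<le> opnorm T"
    by (rule opnorm_le) (auto simp: l opnorm_nonneg assms)
qed

text \<open>For finitely supported vectors this is linearity and the formula for
  \<open>adjm\<close>; the general case follows because both sides are continuous in
  \<open>f\<close>.\<close>

lemma adjm_inner:
  assumes T: "T \<in> bop" and f: "f \<in> l2" and g: "g \<in> l2"
  shows "l2inner (T f) g = l2inner f (adjm T g)"
proof -
  let ?S = "adjm T g"
  have S: "?S \<in> l2" by (rule bop_l2[OF adjm_bop(1)[OF T] g])
  \<comment> \<open>A common Lipschitz constant for the difference of the two sides in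
    \<open>f\<close>; the summand 1 makes it a legitimate divisor.\<close>
  define K where "K = opnorm T * l2norm g + l2norm ?S + 1"
  have K: "K > 0" unfolding K_def
    by (intro add_nonneg_pos add_nonneg_nonneg mult_nonneg_nonneg) (auto simp: opnorm_nonneg T)
  have "cmod (l2inner (T f) g - l2inner f ?S) \<le> \<epsilon>" if e: "\<epsilon> > 0" for \<epsilon>
  proof -
    obtain F where F: "finite F" "l2norm (\<lambda>x. f x - (if x \<in> F then f x else 0)) < \<epsilon> / K"
      using l2_truncate_approx[OF f, of "\<epsilon> / K"] e K by auto
    define v where "v = (\<lambda>x. if x \<in> F then f x else 0)"
    define r where "r = (\<lambda>x. f x - v x)"
    have v: "v \<in> l2" unfolding v_def by (rule l2_truncate[OF f])
    have r: "r \<in> l2" unfolding r_def by (rule l2_diff(1)[OF f v])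
    have nr: "l2norm r < \<epsilon> / K" using F by (simp add: r_def v_def)
    have "l2inner (T v) g = (\<Sum>x\<in>F. v x * l2inner (T (delta x)) g)"
      by (subst bop_finite_support[OF T F(1)])
         (auto simp: v_def l2inner_sum_left l2inner_scale_left bop_l2[OF T] g l2_scale)
    also have "\<dots> = (\<Sum>x\<in>F. v x * cnj (?S x))"
      by (rule sum.cong[OF refl], subst l2inner_commute) (simp add: adjm_def g)
    also have "\<dots> = l2inner v ?S"
      by (rule l2inner_finite_support[OF F(1), symmetric]) (auto simp: v_def)
    finally have v_eq: "l2inner (T v) g = l2inner v ?S" .
    have fe: "f = (\<lambda>x. v x + r x)" by (simp add: r_def)
    have "l2inner (T f) g - l2inner f ?S = l2inner (T r) g - l2inner r ?S"
      by (subst (1 2) fe) (simp add: bop_add[OF T v r] l2inner_add_left v r g S bop_l2[OF T] v_eq)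
    also have "cmod \<dots> \<le> opnorm T * l2norm r * l2norm g + l2norm r * l2norm ?S"
      using norm_triangle_ineq4[of "l2inner (T r) g" "l2inner r ?S"]
        l2inner_bound(2)[OF bop_l2[OF T r] g] l2inner_bound(2)[OF r S]
        mult_right_mono[OF opnorm_bound[OF T r] l2norm_nonneg[of g]] by linarith
    also have "\<dots> \<le> l2norm r * K" by (simp add: K_def algebra_simps)
    also have "\<dots> \<le> \<epsilon>" using nr K by (simp add: field_simps)
    finally show ?thesis .
  qed
  then have "cmod (l2inner (T f) g - l2inner f ?S) \<le> 0"
    using field_le_epsilon[of "cmod (l2inner (T f) g - l2inner f ?S)" 0] by simp
  then show ?thesis by simp
qed

text \<open>Testing against \<open>delta x\<close> recovers every coordinate of \<open>S g\<close>,
  so the definite description has at most one witness.\<close>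

lemma adj_eqI:
  assumes "S \<in> bop" "\<And>f g. f \<in> l2 \<Longrightarrow> g \<in> l2 \<Longrightarrow> l2inner (T f) g = l2inner f (S g)"
  shows "adj T = S"
  unfolding adj_def
proof (rule the_equality)
  fix S' assume S': "S' \<in> bop \<and> (\<forall>f\<in>l2. \<forall>g\<in>l2. l2inner (T f) g = l2inner f (S' g))"
  show "S' = S"
  proof (rule bop_eqI)
    fix g :: "'a vec" assume g: "g \<in> l2"
    have "cnj (S' g x) = cnj (S g x)" for x
      using S' assms(2)[OF l2_delta g, of x] g by (metis l2_delta l2inner_delta_left)
    then show "S' g = S g" by (auto simp: fun_eq_iff)
  qed (use S' assms in auto)
qed (use assms in auto)

lemma adj_eq_adjm: "T \<in> bop \<Longrightarrow> adj T = adjm T"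
  by (rule adj_eqI) (auto simp: adjm_bop adjm_inner)

lemma adj_bop: "T \<in> bop \<Longrightarrow> adj T \<in> bop"
  and opnorm_adj_le: "T \<in> bop \<Longrightarrow> opnorm (adj T) \<le> opnorm T"
  and adj_inner: "T \<in> bop \<Longrightarrow> f \<in> l2 \<Longrightarrow> g \<in> l2 \<Longrightarrow> l2inner (T f) g = l2inner f (adj T g)"
  by (auto simp: adj_eq_adjm adjm_bop adjm_inner)

lemma adj_inner': "T \<in> bop \<Longrightarrow> f \<in> l2 \<Longrightarrow> g \<in> l2 \<Longrightarrow> l2inner (adj T f) g = l2inner f (T g)"
  by (subst (1 2) l2inner_commute) (simp add: adj_inner)

lemma adj_apply: "T \<in> bop \<Longrightarrow> g \<in> l2 \<Longrightarrow> T g x = l2inner g (adj T (delta x))"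
  using adj_inner[of T g "delta x"] by simp

lemma adj_entry: "T \<in> bop \<Longrightarrow> adj T (delta y) x = cnj (T (delta x) y)"
  by (subst adj_eq_adjm) (auto simp: adjm_def)

lemma adj_adj: "T \<in> bop \<Longrightarrow> adj (adj T) = T"
  by (rule adj_eqI) (auto simp: adj_inner')

lemma adj_comp: "T \<in> bop \<Longrightarrow> S \<in> bop \<Longrightarrow> adj (T \<circ> S) = adj S \<circ> adj T"
  by (rule adj_eqI) (auto simp: bop_comp adj_bop adj_inner bop_l2)

lemma adj_op_add: "T \<in> bop \<Longrightarrow> S \<in> bop \<Longrightarrow> adj (op_add T S) = op_add (adj T) (adj S)"
  by (rule adj_eqI) (auto simp: bop_op_add adj_bop, 
      auto simp: op_add_def l2inner_add_left l2inner_add_right adj_inner bop_l2 adj_bop)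

lemma adj_op_scale: "T \<in> bop \<Longrightarrow> adj (op_scale c T) = op_scale (cnj c) (adj T)"
  by (rule adj_eqI) (auto simp: bop_op_scale adj_bop, 
      auto simp: op_scale_def l2inner_scale_left l2inner_scale_right adj_inner)

lemma adj_op_sub: "T \<in> bop \<Longrightarrow> S \<in> bop \<Longrightarrow> adj (op_sub T S) = op_sub (adj T) (adj S)"
  by (simp add: op_sub_conv adj_op_add adj_op_scale bop_op_scale)

lemma adj_ident: "adj ident = ident"
  by (rule adj_eqI[OF ident_bop]) (simp add: ident_def)

lemma bounded_range_cnj: "bounded (range (\<lambda>x. cnj (g x))) \<longleftrightarrow> bounded (range g)"
  by (simp add: bounded_iff)

lemma adj_mult_op:
  assumes "bounded (range g)" shows "adj (mult_op g) = mult_op (\<lambda>x. cnj (g x))"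
proof (rule adj_eqI)
  show "mult_op (\<lambda>x. cnj (g x)) \<in> bop"
    by (rule mult_op_bop) (simp add: bounded_range_cnj assms)
qed (simp add: mult_op_def l2inner_def mult_ac)

subsection \<open>The uniform Roe algebra\<close>

lemma roe_bop: "T \<in> roe \<Longrightarrow> T \<in> bop"
  by (simp add: roe_def)

lemma roeI_finite_prop:
  assumes "T \<in> bop" "finite_prop T" shows "T \<in> roe"
proof -
  have "opnorm (op_sub T T) \<le> 0" by (rule opnorm_le) (auto simp: op_sub_def)
  then show ?thesis using assms unfolding roe_def by (force intro: le_less_trans)
qed

lemma roe_approx:
  assumes "T \<in> roe" "\<epsilon> > 0"
  obtains S where "S \<in> bop" "finite_prop S" "opnorm (op_sub T S) < \<epsilon>"
  using assms by (auto simp: roe_def)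

lemma roe_closed:
  assumes "T \<in> bop" "\<And>\<epsilon>. \<epsilon> > 0 \<Longrightarrow> \<exists>S\<in>roe. opnorm (op_sub T S) < \<epsilon>"
  shows "T \<in> roe"
  unfolding roe_def
proof (safe intro!: assms(1))
  fix \<epsilon> :: real assume e: "\<epsilon> > 0"
  obtain S where S: "S \<in> roe" "opnorm (op_sub T S) < \<epsilon> / 2" using assms(2)[of "\<epsilon> / 2"] e by auto
  obtain R where R: "R \<in> bop" "finite_prop R" "opnorm (op_sub S R) < \<epsilon> / 2"
    using roe_approx[OF S(1), of "\<epsilon> / 2"] e by auto
  have "opnorm (op_sub T R) < \<epsilon>"
    using opnorm_op_sub_triangle[OF assms(1) roe_bop[OF S(1)] R(1)] S R by linarith
  then show "\<exists>S\<in>bop. finite_prop S \<and> opnorm (op_sub T S) < \<epsilon>" using R by blast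
qed

lemma finite_prop_mono: "finite_prop T \<Longrightarrow> \<exists>R\<ge>c. \<forall>x y. T (delta y) x \<noteq> 0 \<longrightarrow> dist x y \<le> R"
  unfolding finite_prop_def by (meson max.cobounded1 max.coboundedI2)

lemma finite_prop_op_add:
  assumes "finite_prop T" "finite_prop S" shows "finite_prop (op_add T S)"
proof -
  obtain R where R: "\<forall>x y. T (delta y) x \<noteq> 0 \<longrightarrow> dist x y \<le> R" using assms(1) by (auto simp: finite_prop_def)
  obtain R' where R': "R' \<ge> R" "\<forall>x y. S (delta y) x \<noteq> 0 \<longrightarrow> dist x y \<le> R'"
    using finite_prop_mono[OF assms(2)] by blast
  have "dist x y \<le> R'" if "op_add T S (delta y) x \<noteq> 0" for x y
    using R R' that by (cases "T (delta y) x = 0") (fastforce simp: op_add_def)+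
  then show ?thesis unfolding finite_prop_def by blast
qed

lemma finite_prop_op_scale: "finite_prop T \<Longrightarrow> finite_prop (op_scale c T)"
  by (auto simp: finite_prop_def op_scale_def)

lemma finite_prop_adj:
  assumes "T \<in> bop" "finite_prop T" shows "finite_prop (adj T)"
  using assms(2) unfolding finite_prop_def adj_entry[OF assms(1)] by (metis complex_cnj_zero dist_commute)

lemma finite_prop_mult_op: "finite_prop (mult_op g)"
  unfolding finite_prop_def by (rule exI[of _ 0]) (auto simp: mult_op_def delta_def)

lemma ulf_finite_ball: "ulf TYPE('a::metric_space) \<Longrightarrow> finite (ball (x::'a) r)"
  by (cases "r > 0") (auto simp: ulf_def ball_empty not_less)

text \<open>Local finiteness makes \<open>S (delta y)\<close> finitely supported, so
  \<open>T\<close> acts on it as a finite sum. A nonzero sum has a nonzero term at some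
  \<open>z\<close>, and the triangle inequality through \<open>z\<close> gives propagation
  \<open>R + R'\<close>.\<close>

lemma finite_prop_comp:
  assumes u: "ulf TYPE('a::metric_space)" and "T \<in> bop" "S \<in> bop" "finite_prop (T :: 'a op)" "finite_prop S"
  shows "finite_prop (T \<circ> S)"
proof -
  obtain R where R: "\<And>x y. T (delta y) x \<noteq> 0 \<Longrightarrow> dist x y \<le> R" using assms(4) by (auto simp: finite_prop_def)
  obtain R' where R': "\<And>x y. S (delta y) x \<noteq> 0 \<Longrightarrow> dist x y \<le> R'" using assms(5) by (auto simp: finite_prop_def)
  have "dist x y \<le> R + R'" if "T (S (delta y)) x \<noteq> 0" for x y
  proof -
    \<comment> \<open>\<open>ball\<close> is open while the propagation bound is not strict, hence
      the summand 1.\<close>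
    let ?F = "ball y (R' + 1)"
    have F: "finite ?F" by (rule ulf_finite_ball[OF u])
    have z: "S (delta y) z = 0" if "z \<notin> ?F" for z
      using R'[of y z] that by (force simp: dist_commute)
    have "(\<Sum>z\<in>?F. S (delta y) z * T (delta z) x) \<noteq> 0"
      using that bop_finite_support[OF assms(2) F z] by simp
    then obtain z where "S (delta y) z * T (delta z) x \<noteq> 0"
      by (rule sum.not_neutral_contains_not_neutral)
    then have "dist z y \<le> R'" "dist x z \<le> R" using R R' by auto
    then show ?thesis using dist_triangle[of x y z] by linarith
  qed
  then show ?thesis unfolding finite_prop_def by auto
qed

section \<open>Algebraic closure properties of the Roe algebra\<close>

lemma roe_op_add:
  assumes "a \<in> roe" "b \<in> roe" shows "op_add a b \<in> roe"
proof (rule roe_closed)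
  fix \<epsilon> :: real assume e: "\<epsilon> > 0"
  obtain S where S: "S \<in> bop" "finite_prop S" "opnorm (op_sub a S) < \<epsilon> / 2"
    using roe_approx[OF assms(1), of "\<epsilon> / 2"] e by auto
  obtain R where R: "R \<in> bop" "finite_prop R" "opnorm (op_sub b R) < \<epsilon> / 2"
    using roe_approx[OF assms(2), of "\<epsilon> / 2"] e by auto
  have "op_sub (op_add a b) (op_add S R) = op_add (op_sub a S) (op_sub b R)"
    by (auto simp: op_sub_def op_add_def fun_eq_iff)
  then have "opnorm (op_sub (op_add a b) (op_add S R)) < \<epsilon>"
    using bop_op_add(2)[of "op_sub a S" "op_sub b R"] S R assms by (simp add: bop_op_sub roe_bop)
  moreover have "op_add S R \<in> roe"
    by (intro roeI_finite_prop bop_op_add finite_prop_op_add S R)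
  ultimately show "\<exists>S\<in>roe. opnorm (op_sub (op_add a b) S) < \<epsilon>" by blast
qed (simp add: assms roe_bop bop_op_add)

lemma roe_op_scale:
  assumes "a \<in> roe" shows "op_scale c a \<in> roe"
proof (rule roe_closed)
  fix \<epsilon> :: real assume e: "\<epsilon> > 0"
  define k where "k = cmod c + 1"
  have k: "k > 0" by (simp add: k_def add_nonneg_pos)
  obtain S where S: "S \<in> bop" "finite_prop S" "opnorm (op_sub a S) < \<epsilon> / k"
    using roe_approx[OF assms(1), of "\<epsilon> / k"] e k by auto
  have b: "op_sub a S \<in> bop" using S assms by (simp add: bop_op_sub roe_bop)
  have "op_sub (op_scale c a) (op_scale c S) = op_scale c (op_sub a S)"
    by (auto simp: op_sub_def op_scale_def algebra_simps)
  then have "opnorm (op_sub (op_scale c a) (op_scale c S)) \<le> cmod c * opnorm (op_sub a S)"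
    using bop_op_scale(2)[OF b] by metis
  also have "\<dots> \<le> k * opnorm (op_sub a S)"
    by (intro mult_right_mono opnorm_nonneg b) (simp add: k_def)
  also have "\<dots> < \<epsilon>" using S(3) k by (simp add: field_simps)
  finally have "opnorm (op_sub (op_scale c a) (op_scale c S)) < \<epsilon>" .
  moreover have "op_scale c S \<in> roe"
    by (intro roeI_finite_prop bop_op_scale finite_prop_op_scale S)
  ultimately show "\<exists>S\<in>roe. opnorm (op_sub (op_scale c a) S) < \<epsilon>" by blast
qed (simp add: assms roe_bop bop_op_scale)

lemma roe_op_sub: "a \<in> roe \<Longrightarrow> b \<in> roe \<Longrightarrow> op_sub a b \<in> roe"
  by (simp add: op_sub_conv roe_op_add roe_op_scale)

lemma roe_adj:
  assumes "a \<in> roe" shows "adj a \<in> roe"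
proof (rule roe_closed)
  fix \<epsilon> :: real assume e: "\<epsilon> > 0"
  obtain S where S: "S \<in> bop" "finite_prop S" "opnorm (op_sub a S) < \<epsilon>"
    using roe_approx[OF assms(1) e] by auto
  have "opnorm (op_sub (adj a) (adj S)) < \<epsilon>"
    using S opnorm_adj_le[of "op_sub a S"] assms by (simp add: adj_op_sub bop_op_sub roe_bop)
  moreover have "adj S \<in> roe"
    by (intro roeI_finite_prop adj_bop finite_prop_adj S)
  ultimately show "\<exists>S\<in>roe. opnorm (op_sub (adj a) S) < \<epsilon>" by blast
qed (simp add: assms roe_bop adj_bop)

lemma roe_mult_op: "bounded (range g) \<Longrightarrow> mult_op g \<in> roe"
  by (intro roeI_finite_prop mult_op_bop finite_prop_mult_op)

lemma roe_ident: "ident \<in> roe"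
  unfolding ident_eq_mult_op by (rule roe_mult_op) auto

lemma opnorm_comp_sub_le:
  assumes "a \<in> bop" "b \<in> bop" "T \<in> bop" "S \<in> bop"
  shows "opnorm (op_sub (a \<circ> b) (T \<circ> S)) \<le> opnorm a * opnorm (op_sub b S) + opnorm (op_sub a T) * opnorm S"
proof -
  have eq: "op_sub (a \<circ> b) (T \<circ> S) = op_add (a \<circ> op_sub b S) (op_sub a T \<circ> S)"
    using assms by (simp add: comp_op_sub_right comp_op_sub_left) (auto simp: op_sub_def op_add_def)
  have "opnorm (op_add (a \<circ> op_sub b S) (op_sub a T \<circ> S))
      \<le> opnorm (a \<circ> op_sub b S) + opnorm (op_sub a T \<circ> S)"
    by (intro bop_op_add bop_comp bop_op_sub assms)
  moreover have "opnorm (a \<circ> op_sub b S) \<le> opnorm a * opnorm (op_sub b S)"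
    by (intro bop_comp bop_op_sub assms)
  moreover have "opnorm (op_sub a T \<circ> S) \<le> opnorm (op_sub a T) * opnorm S"
    by (intro bop_comp bop_op_sub assms)
  ultimately show ?thesis unfolding eq by linarith
qed

lemma roe_comp:
  assumes u: "ulf TYPE('a::metric_space)" and "a \<in> roe" "b \<in> roe" shows "(a :: 'a op) \<circ> b \<in> roe"
proof (rule roe_closed)
  note bop = assms(2,3)[THEN roe_bop]
  fix \<epsilon> :: real assume e: "\<epsilon> > 0"
  define k where "k = opnorm a + 1"
  have k: "k > 0" using opnorm_nonneg[OF bop(1)] by (simp add: k_def)
  \<comment> \<open>\<open>S\<close> is fixed first, because the tolerance for \<open>T\<close>
    depends on \<open>opnorm S\<close>.\<close>
  obtain S where S: "S \<in> bop" "finite_prop S" "opnorm (op_sub b S) < \<epsilon> / 2 / k"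
    using roe_approx[OF assms(3), of "\<epsilon> / 2 / k"] e k by auto
  define l where "l = opnorm S + 1"
  have l: "l > 0" using opnorm_nonneg[OF S(1)] by (simp add: l_def)
  obtain T where T: "T \<in> bop" "finite_prop T" "opnorm (op_sub a T) < \<epsilon> / 2 / l"
    using roe_approx[OF assms(2), of "\<epsilon> / 2 / l"] e l by auto
  have "opnorm a * opnorm (op_sub b S) \<le> k * opnorm (op_sub b S)"
    by (intro mult_right_mono opnorm_nonneg bop_op_sub bop S) (simp add: k_def)
  also have "\<dots> < \<epsilon> / 2" using S(3) k by (simp add: field_simps)
  finally have 1: "opnorm a * opnorm (op_sub b S) < \<epsilon> / 2" .
  have "opnorm (op_sub a T) * opnorm S \<le> opnorm (op_sub a T) * l"
    by (intro mult_left_mono opnorm_nonneg bop_op_sub bop T) (simp add: l_def)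
  also have "\<dots> < \<epsilon> / 2" using T(3) l by (simp add: field_simps)
  finally have "opnorm (op_sub (a \<circ> b) (T \<circ> S)) < \<epsilon>"
    using 1 opnorm_comp_sub_le[OF bop T(1) S(1)] by linarith
  moreover have "T \<circ> S \<in> roe"
    by (intro roeI_finite_prop bop_comp finite_prop_comp u S T)
  ultimately show "\<exists>S\<in>roe. opnorm (op_sub (a \<circ> b) S) < \<epsilon>" by blast
qed (simp add: assms roe_bop bop_comp)

subsection \<open>Compact operators\<close>

text \<open>Frees the index set from being an initial segment of the naturals, so that a sum of
  operators can be indexed by a disjoint union and a diagonal operator by its support.\<close>

lemma finite_rankI:
  assumes "finite I" "\<And>i. i \<in> I \<Longrightarrow> u i \<in> l2 \<and> v i \<in> l2"
    and "\<And>f. f \<in> l2 \<Longrightarrow> T f = (\<lambda>x. \<Sum>i\<in>I. l2inner f (v i) * u i x)"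
  shows "finite_rank T"
proof -
  obtain e where e: "bij_betw e {0..<card I} I" using ex_bij_betw_nat_finite[OF assms(1)] by blast
  then have e': "bij_betw e {..<card I} I" by (simp add: lessThan_atLeast0)
  have "(\<Sum>i\<in>I. l2inner f (v i) * u i x) = (\<Sum>n<card I. l2inner f (v (e n)) * u (e n) x)" for f x
    by (rule sum.reindex_bij_betw[OF e', symmetric])
  moreover have "e n \<in> I" if "n < card I" for n using e' that by (auto simp: bij_betw_def)
  ultimately show ?thesis using assms(2,3)
    unfolding finite_rank_def by (intro exI[of _ "card I"] exI[of _ "u \<circ> e"] exI[of _ "v \<circ> e"]) auto
qed

lemma finite_rank_op_add:
  assumes "finite_rank T" "finite_rank S" shows "finite_rank (op_add T S)"
proof -
  obtain n u v where T: "\<forall>i<n::nat. u i \<in> l2 \<and> v i \<in> l2"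
    "\<forall>f\<in>l2. T f = (\<lambda>x. \<Sum>i<n. l2inner f (v i) * u i x)"
    using assms(1) unfolding finite_rank_def by blast
  obtain m u' v' where S: "\<forall>i<m::nat. u' i \<in> l2 \<and> v' i \<in> l2"
    "\<forall>f\<in>l2. S f = (\<lambda>x. \<Sum>i<m. l2inner f (v' i) * u' i x)"
    using assms(2) unfolding finite_rank_def by blast
  show ?thesis
    by (rule finite_rankI[of "{..<n} <+> {..<m}" "case_sum u u'" "case_sum v v'"])
       (use T S in \<open>auto simp: op_add_def sum.Plus\<close>)
qed

lemma finite_rank_comp_left:
  assumes "a \<in> bop" "finite_rank T" "T \<in> bop" shows "finite_rank (a \<circ> T)"
proof -
  obtain n u v where T: "\<forall>i<n::nat. u i \<in> l2 \<and> v i \<in> l2"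
    "\<forall>f\<in>l2. T f = (\<lambda>x. \<Sum>i<n. l2inner f (v i) * u i x)"
    using assms(2) unfolding finite_rank_def by blast
  have "a (\<lambda>x. \<Sum>i<n. l2inner f (v i) * u i x) = (\<lambda>x. \<Sum>i<n. l2inner f (v i) * a (u i) x)" for f
    using T(1) by (subst bop_sum[OF assms(1)]) (auto simp: l2_scale bop_scale[OF assms(1)])
  then show ?thesis
    by (intro finite_rankI[of "{..<n}" "\<lambda>i. a (u i)" v]) (use T assms in \<open>auto simp: bop_l2\<close>)
qed

text \<open>The operator \<open>a\<close> is absorbed into the functionals:
  \<open>l2inner (a f) (v i)\<close> is \<open>l2inner f (adj a (v i))\<close>.\<close>

lemma finite_rank_comp_right:
  assumes "a \<in> bop" "finite_rank T" shows "finite_rank (T \<circ> a)"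
proof -
  obtain n u v where T: "\<forall>i<n::nat. u i \<in> l2 \<and> v i \<in> l2"
    "\<forall>f\<in>l2. T f = (\<lambda>x. \<Sum>i<n. l2inner f (v i) * u i x)"
    using assms(2) unfolding finite_rank_def by blast
  show ?thesis
    by (rule finite_rankI[of "{..<n}" u "\<lambda>i. adj a (v i)"])
       (use T assms in \<open>auto simp: bop_l2 adj_bop adj_inner\<close>)
qed

lemma finite_rank_mult_op:
  assumes "finite F" shows "finite_rank (mult_op (\<lambda>x. if x \<in> F then g x else 0))"
proof (rule finite_rankI[OF assms])
  show "(\<lambda>y. g x * delta x y) \<in> l2 \<and> delta x \<in> l2" for x by (simp add: l2_scale)
  have "(\<Sum>x\<in>F. f x * (g x * delta x y)) = (if y \<in> F then g y * f y else 0)" for f :: "'a vec" and y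
    by (subst sum.cong[OF refl, where h="\<lambda>x. if y = x then f x * g x else 0"])
       (auto simp: delta_def assms)
  then show "mult_op (\<lambda>x. if x \<in> F then g x else 0) f = (\<lambda>y. \<Sum>x\<in>F. l2inner f (delta x) * (g x * delta x y))"
    if "f \<in> l2" for f using that by (auto simp: mult_op_def)
qed

lemma compact_bop: "T \<in> compact_ops \<Longrightarrow> T \<in> bop"
  by (simp add: compact_ops_def)

lemma compact_approx:
  assumes "T \<in> compact_ops" "\<epsilon> > 0"
  obtains S where "S \<in> bop" "finite_rank S" "opnorm (op_sub T S) < \<epsilon>"
  using assms by (auto simp: compact_ops_def)

lemma compactI:
  assumes "T \<in> bop" "\<And>\<epsilon>. \<epsilon> > 0 \<Longrightarrow> \<exists>S\<in>bop. finite_rank S \<and> opnorm (op_sub T S) \<le> \<epsilon>"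
  shows "T \<in> compact_ops"
proof -
  have "\<exists>S\<in>bop. finite_rank S \<and> opnorm (op_sub T S) < \<epsilon>" if "\<epsilon> > 0" for \<epsilon> :: real
    using assms(2)[of "\<epsilon> / 2"] that by (auto intro: le_less_trans)
  then show ?thesis using assms(1) by (simp add: compact_ops_def)
qed

lemma compact_closed:
  assumes "T \<in> bop" "\<And>\<epsilon>. \<epsilon> > 0 \<Longrightarrow> \<exists>S\<in>compact_ops. opnorm (op_sub T S) \<le> \<epsilon>"
  shows "T \<in> compact_ops"
proof (rule compactI[OF assms(1)])
  fix \<epsilon> :: real assume e: "\<epsilon> > 0"
  obtain S where S: "S \<in> compact_ops" "opnorm (op_sub T S) \<le> \<epsilon> / 2" using assms(2)[of "\<epsilon> / 2"] e by auto
  obtain R where R: "R \<in> bop" "finite_rank R" "opnorm (op_sub S R) < \<epsilon> / 2"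
    using compact_approx[OF S(1), of "\<epsilon> / 2"] e by auto
  have "opnorm (op_sub T R) \<le> \<epsilon>"
    using opnorm_op_sub_triangle[OF assms(1) compact_bop[OF S(1)] R(1)] S R by linarith
  then show "\<exists>S\<in>bop. finite_rank S \<and> opnorm (op_sub T S) \<le> \<epsilon>" using R by blast
qed

lemma compact_comp_right:
  assumes "K \<in> compact_ops" "a \<in> bop" shows "K \<circ> a \<in> compact_ops"
proof (rule compactI)
  note K = compact_bop[OF assms(1)]
  show "K \<circ> a \<in> bop" using K assms by (simp add: bop_comp)
  fix \<epsilon> :: real assume e: "\<epsilon> > 0"
  define k where "k = opnorm a + 1"
  have k: "k > 0" using opnorm_nonneg[OF assms(2)] by (simp add: k_def)
  obtain S where S: "S \<in> bop" "finite_rank S" "opnorm (op_sub K S) < \<epsilon> / k"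
    using compact_approx[OF assms(1), of "\<epsilon> / k"] e k by auto
  have "opnorm (op_sub (K \<circ> a) (S \<circ> a)) \<le> opnorm (op_sub K S) * opnorm a"
    using bop_comp(2)[of "op_sub K S" a] assms K S by (simp add: comp_op_sub_left bop_op_sub)
  also have "\<dots> \<le> opnorm (op_sub K S) * k"
    by (intro mult_left_mono opnorm_nonneg bop_op_sub K S) (simp add: k_def)
  also have "\<dots> \<le> \<epsilon>" using S(3) k by (simp add: field_simps)
  finally show "\<exists>S\<in>bop. finite_rank S \<and> opnorm (op_sub (K \<circ> a) S) \<le> \<epsilon>"
    using S assms by (intro bexI[of _ "S \<circ> a"] conjI finite_rank_comp_right bop_comp)
qed

lemma compact_comp_left:
  assumes "K \<in> compact_ops" "a \<in> bop" shows "a \<circ> K \<in> compact_ops"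
proof (rule compactI)
  note K = compact_bop[OF assms(1)]
  show "a \<circ> K \<in> bop" using K assms by (simp add: bop_comp)
  fix \<epsilon> :: real assume e: "\<epsilon> > 0"
  define k where "k = opnorm a + 1"
  have k: "k > 0" using opnorm_nonneg[OF assms(2)] by (simp add: k_def)
  obtain S where S: "S \<in> bop" "finite_rank S" "opnorm (op_sub K S) < \<epsilon> / k"
    using compact_approx[OF assms(1), of "\<epsilon> / k"] e k by auto
  have "opnorm (op_sub (a \<circ> K) (a \<circ> S)) \<le> opnorm a * opnorm (op_sub K S)"
    using bop_comp(2)[of a "op_sub K S"] assms K S by (simp add: comp_op_sub_right bop_op_sub)
  also have "\<dots> \<le> k * opnorm (op_sub K S)"
    by (intro mult_right_mono opnorm_nonneg bop_op_sub K S) (simp add: k_def)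
  also have "\<dots> \<le> \<epsilon>" using S(3) k by (simp add: field_simps)
  finally show "\<exists>S\<in>bop. finite_rank S \<and> opnorm (op_sub (a \<circ> K) S) \<le> \<epsilon>"
    using S assms by (intro bexI[of _ "a \<circ> S"] conjI finite_rank_comp_left bop_comp)
qed

section \<open>Compactness of multiplication operators\<close>

lemma c0_bounded:
  assumes "c0 f" shows "bounded (range f)"
proof -
  have "finite {x. cmod (f x) \<ge> 1}" using assms by (simp add: c0_def)
  then have "bounded (f ` {x. cmod (f x) \<ge> 1} \<union> ball 0 1)"
    by (simp add: finite_imp_bounded)
  moreover have "range f \<subseteq> f ` {x. cmod (f x) \<ge> 1} \<union> ball 0 1" by force
  ultimately show ?thesis by (rule bounded_subset)
qed

lemma c0_imp_compact:
  assumes "c0 f" shows "mult_op f \<in> compact_ops"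
proof (rule compactI)
  show "mult_op f \<in> bop" by (rule mult_op_bop[OF c0_bounded[OF assms]])
  fix \<epsilon> :: real assume e: "\<epsilon> > 0"
  define F where "F = {x. cmod (f x) \<ge> \<epsilon>}"
  let ?g = "\<lambda>x. if x \<in> F then f x else 0"
  have F: "finite F" using assms e by (simp add: c0_def F_def)
  have "bounded (range ?g)"
    by (rule bounded_subset[of "insert 0 (f ` F)"]) (auto intro: finite_imp_bounded F)
  then have "mult_op ?g \<in> bop" by (rule mult_op_bop)
  moreover have "finite_rank (mult_op ?g)" by (rule finite_rank_mult_op[OF F])
  moreover have "opnorm (op_sub (mult_op f) (mult_op ?g)) \<le> \<epsilon>"
    unfolding op_sub_mult_op by (rule mult_op_bop_bound) (use e in \<open>auto simp: F_def\<close>)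
  ultimately show "\<exists>S\<in>bop. finite_rank S \<and> opnorm (op_sub (mult_op f) S) \<le> \<epsilon>" by blast
qed

lemma l2_c0:
  assumes "f \<in> l2" shows "c0 f"
  unfolding c0_def
proof safe
  fix \<epsilon> :: real assume "\<epsilon> > 0"
  then obtain F where F: "finite F" "l2norm (\<lambda>x. f x - (if x \<in> F then f x else 0)) < \<epsilon>"
    using l2_truncate_approx[OF assms] by blast
  have "cmod (f x) < \<epsilon>" if "x \<notin> F" for x
    using cmod_le_l2norm[OF l2_diff(1)[OF assms l2_truncate[OF assms]], of x F] F(2) that by simp
  then have "{x. cmod (f x) \<ge> \<epsilon>} \<subseteq> F" by force
  then show "finite {x. cmod (f x) \<ge> \<epsilon>}" using F(1) finite_subset by blast
qed

text \<open>Compare diagonal entries. That of \<open>mult_op f\<close> at \<open>x\<close> is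
  \<open>f x\<close>; that of a finite-rank operator is a finite sum of products
  \<open>cnj (v i x) * u i x\<close>, small off a finite set because each \<open>v i\<close> is
  square summable and so tends to 0.\<close>

lemma compact_imp_c0:
  assumes "mult_op f \<in> compact_ops" shows "c0 f"
  unfolding c0_def
proof safe
  fix \<epsilon> :: real assume e: "\<epsilon> > 0"
  obtain S where S: "S \<in> bop" "finite_rank S" "opnorm (op_sub (mult_op f) S) < \<epsilon> / 2"
    using compact_approx[OF assms, of "\<epsilon> / 2"] e by auto
  obtain n u v where uv: "\<forall>i<n::nat. u i \<in> l2 \<and> v i \<in> l2"
    "\<forall>f\<in>l2. S f = (\<lambda>x. \<Sum>i<n. l2inner f (v i) * u i x)"
    using S(2) unfolding finite_rank_def by blast
  define k where "k = (\<Sum>i<n. l2norm (u i)) + 1"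
  have k: "k > 0" by (simp add: k_def add_nonneg_pos sum_nonneg)
  define B where "B = (\<Union>i<n. {x. cmod (v i x) \<ge> \<epsilon> / 2 / k})"
  have B: "finite B" unfolding B_def
  proof (rule finite_UN_I)
    fix i assume "i \<in> {..<n}"
    then have "c0 (v i)" using uv(1) l2_c0 by auto
    moreover have "\<epsilon> / 2 / k > 0" using e k by simp
    ultimately show "finite {x. cmod (v i x) \<ge> \<epsilon> / 2 / k}" unfolding c0_def by blast
  qed simp
  have "cmod (f x) < \<epsilon>" if x: "x \<notin> B" for x
  proof -
    let ?D = "op_sub (mult_op f) S"
    have D: "?D \<in> bop" using S assms by (simp add: bop_op_sub compact_bop)
    have "?D (delta x) x = f x - S (delta x) x" by (simp add: op_sub_def mult_op_def) (simp add: delta_def)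
    moreover have "cmod (?D (delta x) x) \<le> l2norm (?D (delta x))"
      by (rule cmod_le_l2norm[OF bop_l2[OF D l2_delta]])
    ultimately have 1: "cmod (f x - S (delta x) x) < \<epsilon> / 2"
      using S(3) opnorm_bound[OF D l2_delta, of x] by simp
    have "cmod (S (delta x) x) = cmod (\<Sum>i<n. cnj (v i x) * u i x)"
      using uv(2) by simp
    also have "\<dots> \<le> (\<Sum>i<n. cmod (v i x) * cmod (u i x))"
      by (rule norm_sum[THEN order_trans]) (simp add: norm_mult)
    also have "\<dots> \<le> (\<Sum>i<n. \<epsilon> / 2 / k * l2norm (u i))"
      by (rule sum_mono, rule mult_mono)
         (use x uv(1) e k in \<open>auto simp: B_def not_le intro: less_imp_le cmod_le_l2norm\<close>)
    also have "\<dots> = \<epsilon> / 2 / k * (k - 1)" by (simp add: k_def sum_distrib_left)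
    also have "\<dots> \<le> \<epsilon> / 2" using e k by (simp add: field_simps)
    finally show ?thesis using 1 norm_triangle_sub[of "f x" "S (delta x) x"] by linarith
  qed
  then have "{x. cmod (f x) \<ge> \<epsilon>} \<subseteq> B" by force
  then show "finite {x. cmod (f x) \<ge> \<epsilon>}" using B finite_subset by blast
qed

subsection \<open>Higson functions commute with the Roe algebra modulo compact operators\<close>

text \<open>A Schur-type estimate for band matrices. In the squared norm, Cauchy-Schwarz in each row
  costs one factor \<open>N\<close>, and exchanging the double sum costs another, since each
  \<open>y\<close> occurs in at most \<open>N\<close> rows.\<close>

lemma opnorm_le_of_entries:
  fixes T :: "('a::metric_space) op"
  assumes T: "T \<in> bop" and e: "e \<ge> 0"
    and entry: "\<And>x y. cmod (T (delta y) x) \<le> e"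
    and supp: "\<And>x y. T (delta y) x \<noteq> 0 \<Longrightarrow> dist x y < r"
    and balls: "\<And>x::'a. finite (ball x r) \<and> card (ball x r) \<le> N"
  shows "opnorm T \<le> real N * e"
proof (rule opnorm_le)
  fix v :: "'a vec" assume v: "v \<in> l2"
  define q where "q = (\<lambda>y. (cmod (v y))\<^sup>2)"
  have q0: "q y \<ge> 0" for y by (simp add: q_def)
  have pt: "(cmod (T v x))\<^sup>2 \<le> e\<^sup>2 * N * (\<Sum>y\<in>ball x r. q y)" for x
  proof -
    \<comment> \<open>Row \<open>x\<close> is read off through the adjoint: \<open>v\<close> may
      have infinite support, but \<open>adj T (delta x)\<close> lives in the ball.\<close>
    have "T v x = (\<Sum>y\<in>ball x r. v y * cnj (adj T (delta x) y))"
      unfolding adj_apply[OF T v]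
    proof (rule l2inner_finite_support)
      show "v y = 0 \<or> adj T (delta x) y = 0" if "y \<notin> ball x r" for y
        using supp[of y x] that by (auto simp: adj_entry[OF T])
    qed (use balls in auto)
    then have "cmod (T v x) \<le> (\<Sum>y\<in>ball x r. cmod (v y) * cmod (T (delta y) x))"
      by (simp add: adj_entry[OF T] norm_sum norm_mult[symmetric])
    also have "\<dots> \<le> (\<Sum>y\<in>ball x r. cmod (v y) * e)"
      by (intro sum_mono mult_left_mono entry) auto
    also have "\<dots> = e * (\<Sum>y\<in>ball x r. \<bar>1\<bar> * \<bar>cmod (v y)\<bar>)"
      by (simp add: sum_distrib_left mult.commute)
    also have "\<dots> \<le> e * (L2_set (\<lambda>_. 1) (ball x r) * L2_set (\<lambda>y. cmod (v y)) (ball x r))"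
      by (intro mult_left_mono L2_set_mult_ineq e)
    finally have "(cmod (T v x))\<^sup>2 \<le> (e * (L2_set (\<lambda>_. 1) (ball x r) * L2_set (\<lambda>y. cmod (v y)) (ball x r)))\<^sup>2"
      by (rule power_mono) simp
    also have "\<dots> = e\<^sup>2 * card (ball x r) * (\<Sum>y\<in>ball x r. q y)"
      by (simp add: power_mult_distrib L2_set_def sum_nonneg q_def)
    also have "\<dots> \<le> e\<^sup>2 * N * (\<Sum>y\<in>ball x r. q y)"
      using balls[of x] by (intro mult_right_mono mult_left_mono sum_nonneg q0) auto
    finally show ?thesis .
  qed
  have "L2_set (\<lambda>x. cmod (T v x)) F \<le> real N * e * l2norm v" if F: "finite F" for F
  proof -
    define G where "G = (\<Union>x\<in>F. ball x r)"
    have G: "finite G" using F balls by (auto simp: G_def)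
    have b: "ball x r = {y \<in> G. dist x y < r}" if "x \<in> F" for x using that by (auto simp: G_def)
    have "(\<Sum>x\<in>F. (cmod (T v x))\<^sup>2) \<le> (\<Sum>x\<in>F. e\<^sup>2 * N * (\<Sum>y\<in>ball x r. q y))"
      by (intro sum_mono pt)
    also have "\<dots> = e\<^sup>2 * N * (\<Sum>x\<in>F. \<Sum>y | y \<in> G \<and> dist x y < r. q y)"
      by (simp add: sum_distrib_left b)
    also have "(\<Sum>x\<in>F. \<Sum>y | y \<in> G \<and> dist x y < r. q y) = (\<Sum>y\<in>G. \<Sum>x | x \<in> F \<and> dist x y < r. q y)"
      by (rule sum.swap_restrict[OF F G])
    also have "\<dots> \<le> (\<Sum>y\<in>G. real N * q y)"
    proof (rule sum_mono)
      fix y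
      have "card {x \<in> F. dist x y < r} \<le> card (ball y r)"
        by (rule card_mono) (use balls in \<open>auto simp: dist_commute\<close>)
      then have "card {x \<in> F. dist x y < r} \<le> N" using balls le_trans by blast
      then show "(\<Sum>x | x \<in> F \<and> dist x y < r. q y) \<le> real N * q y"
        by (simp add: mult_right_mono q0)
    qed
    also have "\<dots> = real N * (L2_set (\<lambda>y. cmod (v y)) G)\<^sup>2"
      by (simp add: sum_distrib_left[symmetric] L2_set_def sum_nonneg q_def)
    also have "\<dots> \<le> real N * (l2norm v)\<^sup>2"
      by (intro mult_left_mono power_mono L2_set_le_l2norm v) auto
    finally have "(\<Sum>x\<in>F. (cmod (T v x))\<^sup>2) \<le> e\<^sup>2 * N * (real N * (l2norm v)\<^sup>2)"
      by (simp add: mult_left_mono)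
    also have "\<dots> = (real N * e * l2norm v)\<^sup>2" by (simp add: power2_eq_square mult_ac)
    finally show ?thesis
      by (subst (asm) sum_sq_le_iff_L2_set) (use e in auto)
  qed
  then show "l2norm (T v) \<le> real N * e * l2norm v" by (rule l2_bound(2))
qed (use e in simp)

definition commutator :: "'a vec \<Rightarrow> 'a op \<Rightarrow> 'a op" where
  "commutator f a = op_sub (mult_op f \<circ> a) (a \<circ> mult_op f)"

lemma commutator_bop: "bounded (range f) \<Longrightarrow> a \<in> bop \<Longrightarrow> commutator f a \<in> bop"
  unfolding commutator_def by (intro bop_op_sub bop_comp mult_op_bop)

lemma mult_op_delta: "mult_op f (delta y) = (\<lambda>x. f y * delta y x)"
  by (simp add: mult_op_def) (auto simp: delta_def)

lemma commutator_entry: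
  assumes "a \<in> bop"
  shows "commutator f a (delta y) x = (f x - f y) * a (delta y) x"
proof -
  have "a (mult_op f (delta y)) x = f y * a (delta y) x"
    unfolding mult_op_delta using bop_scale[OF assms l2_delta] by metis
  moreover have "mult_op f (a (delta y)) x = f x * a (delta y) x"
    using bop_l2[OF assms l2_delta] by (simp add: mult_op_def)
  ultimately show ?thesis by (simp add: commutator_def op_sub_def algebra_simps)
qed

text \<open>The entries are \<open>(f x - f y) * S (delta y) x\<close>. Off a finite set
  \<open>F\<close> the first factor is uniformly small at bounded distance, so the compression to
  the complement of \<open>F\<close> has small norm by the band estimate; the rest has finite
  rank.\<close>

lemma commutator_finite_prop_compact:
  fixes S :: "('a::metric_space) op"
  assumes u: "ulf TYPE('a)" and f: "higson f" and S: "S \<in> bop" "finite_prop S"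
  shows "commutator f S \<in> compact_ops"
proof (rule compactI)
  have bf: "bounded (range f)" using f by (simp add: higson_def)
  show T: "commutator f S \<in> bop" by (rule commutator_bop[OF bf S(1)])
  let ?T = "commutator f S"
  fix \<epsilon> :: real assume e: "\<epsilon> > 0"
  obtain R where R: "R \<ge> 0" "\<And>x y. S (delta y) x \<noteq> 0 \<Longrightarrow> dist x y \<le> R"
    using finite_prop_mono[OF S(2), of 0] by blast
  define r where "r = R + 1"
  have r: "r > 0" using R by (simp add: r_def)
  obtain N where N: "\<And>x::'a. finite (ball x r) \<and> card (ball x r) \<le> N"
    using u r unfolding ulf_def by blast
  \<comment> \<open>The band estimate will give the bound
    \<open>real N * (\<eta> * opnorm S)\<close>, which this \<open>k\<close> keeps below
    \<epsilon>.\<close>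
  define k where "k = real N * opnorm S + 1"
  have k: "k > 0" using opnorm_nonneg[OF S(1)] by (simp add: k_def add_nonneg_pos)
  define \<eta> where "\<eta> = \<epsilon> / k"
  have eta: "\<eta> > 0" using e k by (simp add: \<eta>_def)
  obtain F where F: "finite F" "\<And>x y. x \<notin> F \<and> y \<notin> F \<and> dist x y < r \<Longrightarrow> cmod (f x - f y) < \<eta>"
    using f eta r unfolding higson_def by blast
  define Q :: "'a op" where "Q = mult_op (\<lambda>x. if x \<in> F then 1 else 0)"
  define P :: "'a op" where "P = mult_op (\<lambda>x. if x \<in> F then 0 else 1)"
  have QP: "Q \<in> bop" "P \<in> bop" unfolding Q_def P_def
    by (rule mult_op_bop_bound(1)[of _ 1]; simp)+
  have fQ: "finite_rank Q" unfolding Q_def by (rule finite_rank_mult_op[OF F(1)])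
  \<comment> \<open>\<open>Q\<close> and \<open>P\<close> are complementary projections, so T = QT +
    PTQ + PTP; the first two terms contain the finite-rank factor \<open>Q\<close>.\<close>
  define K where "K = op_add (Q \<circ> ?T) (P \<circ> ?T \<circ> Q)"
  have K: "K \<in> bop" unfolding K_def by (intro bop_op_add bop_comp QP T)
  have fK: "finite_rank K" unfolding K_def
    by (intro finite_rank_op_add finite_rank_comp_right finite_rank_comp_left fQ QP T bop_comp)
  have dec: "op_sub ?T K = P \<circ> ?T \<circ> P"
  proof (rule bop_eqI)
    fix v :: "'a vec" assume v: "v \<in> l2"
    have Pv: "P v \<in> l2" "Q v \<in> l2" using bop_l2 QP v by auto
    have "v = (\<lambda>x. P v x + Q v x)" using v by (auto simp: P_def Q_def mult_op_def)
    then have A: "?T v = (\<lambda>x. ?T (P v) x + ?T (Q v) x)" using bop_add[OF T Pv] by simp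
    have "w = (\<lambda>x. P w x + Q w x)" if "w \<in> l2" for w
      using that by (auto simp: P_def Q_def mult_op_def)
    then have B: "?T v x = P (?T v) x + Q (?T v) x" for x using bop_l2[OF T v] by metis
    have C: "P (?T v) = (\<lambda>x. P (?T (P v)) x + P (?T (Q v)) x)"
      using bop_add[OF QP(2) bop_l2[OF T Pv(1)] bop_l2[OF T Pv(2)]] unfolding A[symmetric] by simp
    have "?T v x - (Q (?T v) x + P (?T (Q v)) x) = P (?T (P v)) x" for x
      using B[of x] fun_cong[OF C, of x] by simp
    then show "op_sub ?T K v = (P \<circ> ?T \<circ> P) v"
      by (simp add: op_sub_def K_def op_add_def)
  qed (intro bop_op_sub bop_comp QP T K)+
  have ent: "(P \<circ> ?T \<circ> P) (delta y) x = (if x \<in> F \<or> y \<in> F then 0 else (f x - f y) * S (delta y) x)" for x y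
  proof (cases "y \<in> F")
    case True
    then have "P (delta y) = (\<lambda>_. 0)" by (auto simp: P_def mult_op_delta)
    then show ?thesis using True bop_zero[OF T] bop_zero[OF QP(2)] by simp
  next
    case False
    then have "P (delta y) = delta y" by (auto simp: P_def mult_op_delta)
    then show ?thesis using False bop_l2[OF T l2_delta]
      by (simp add: P_def mult_op_def commutator_entry[OF S(1)])
  qed
  have sy: "cmod (S (delta y) x) \<le> opnorm S" for x y
    using cmod_le_l2norm[OF bop_l2[OF S(1) l2_delta], of y x] opnorm_bound[OF S(1) l2_delta, of y] by simp
  have "opnorm (P \<circ> ?T \<circ> P) \<le> real N * (\<eta> * opnorm S)"
  proof (rule opnorm_le_of_entries[where r = r])
    show "cmod ((P \<circ> ?T \<circ> P) (delta y) x) \<le> \<eta> * opnorm S" for x y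
    proof (cases "x \<in> F \<or> y \<in> F \<or> S (delta y) x = 0")
      case True
      then show ?thesis using eta opnorm_nonneg[OF S(1)] ent[of y x] by auto
    next
      case False
      then have "dist x y < r" using R(2)[of y x] by (simp add: r_def)
      then have "cmod (f x - f y) < \<eta>" using F(2) False by blast
      then have "cmod (f x - f y) * cmod (S (delta y) x) \<le> \<eta> * opnorm S"
        using eta by (intro mult_mono sy) auto
      then show ?thesis unfolding ent using False by (simp add: norm_mult)
    qed
    show "dist x y < r" if "(P \<circ> ?T \<circ> P) (delta y) x \<noteq> 0" for x y
      using that R(2)[of y x] unfolding ent by (auto simp: r_def split: if_splits)
  qed (use N eta opnorm_nonneg[OF S(1)] in \<open>auto intro!: bop_comp QP T\<close>)
  also have "\<dots> \<le> \<eta> * k" using eta by (simp add: k_def algebra_simps)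
  also have "\<dots> = \<epsilon>" using k by (simp add: \<eta>_def)
  finally show "\<exists>S'\<in>bop. finite_rank S' \<and> opnorm (op_sub ?T S') \<le> \<epsilon>"
    using K fK dec by metis
qed

text \<open>Passage to the norm limit: \<open>commutator f\<close> is linear in \<open>a\<close>
  with bound \<open>2 * opnorm (mult_op f)\<close>, and the compact operators are norm
  closed.\<close>

lemma commutator_compact:
  fixes a :: "('a::metric_space) op"
  assumes u: "ulf TYPE('a)" and f: "higson f" and a: "a \<in> roe"
  shows "commutator f a \<in> compact_ops"
proof (rule compact_closed)
  have bf: "bounded (range f)" using f by (simp add: higson_def)
  note b = roe_bop[OF a]
  show "commutator f a \<in> bop" by (rule commutator_bop[OF bf b])
  fix \<epsilon> :: real assume e: "\<epsilon> > 0"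
  note m = mult_op_bop[OF bf]
  define k where "k = 2 * opnorm (mult_op f) + 1"
  have k: "k > 0" using opnorm_nonneg[OF m] by (simp add: k_def)
  obtain S where S: "S \<in> bop" "finite_prop S" "opnorm (op_sub a S) < \<epsilon> / k"
    using roe_approx[OF a, of "\<epsilon> / k"] e k by auto
  let ?d = "op_sub a S"
  have d: "?d \<in> bop" using b S by (simp add: bop_op_sub)
  have eq: "op_sub (commutator f a) (commutator f S) = op_sub (mult_op f \<circ> ?d) (?d \<circ> mult_op f)"
    unfolding commutator_def comp_op_sub_right[OF m b S(1)] comp_op_sub_left
    by (auto simp: op_sub_def fun_eq_iff)
  have "opnorm (op_sub (commutator f a) (commutator f S)) \<le> opnorm (mult_op f \<circ> ?d) + opnorm (?d \<circ> mult_op f)"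
    unfolding eq by (intro bop_op_sub bop_comp m d)
  also have "\<dots> \<le> opnorm (mult_op f) * opnorm ?d + opnorm ?d * opnorm (mult_op f)"
    by (intro add_mono bop_comp m d)
  also have "\<dots> \<le> k * opnorm ?d" using opnorm_nonneg[OF d] by (simp add: k_def algebra_simps)
  also have "\<dots> \<le> \<epsilon>" using S(3) k by (simp add: field_simps)
  finally show "\<exists>S\<in>compact_ops. opnorm (op_sub (commutator f a) S) \<le> \<epsilon>"
    using commutator_finite_prop_compact[OF u f S(1,2)] by blast
qed

subsection \<open>Completeness and square roots\<close>

text \<open>The limit is taken coordinatewise. The explicit rate \<open>e\<close> survives: for a
  fixed finite set of coordinates the bound on \<open>X m - X n\<close> persists as m tends to
  infinity, and then the finite set is arbitrary.\<close>

lemma roe_complete: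
  fixes X :: "nat \<Rightarrow> ('a::metric_space) op"
  assumes X: "\<And>n. X n \<in> roe" and e: "e \<longlonglongrightarrow> 0"
    and cauchy: "\<And>m n. n \<le> m \<Longrightarrow> opnorm (op_sub (X m) (X n)) \<le> e n"
  shows "\<exists>L\<in>roe. \<forall>n. opnorm (op_sub L (X n)) \<le> e n"
proof -
  note b = roe_bop[OF X]
  have e0: "e n \<ge> 0" for n
    using cauchy[of n n] opnorm_nonneg[OF bop_op_sub(1)[OF b b], of n n] by linarith
  have d: "l2norm (\<lambda>x. X m f x - X n f x) \<le> e n * l2norm f" if "n \<le> m" "f \<in> l2" for m n f
  proof -
    have "l2norm (op_sub (X m) (X n) f) \<le> opnorm (op_sub (X m) (X n)) * l2norm f"
      by (intro opnorm_bound bop_op_sub b that)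
    also have "\<dots> \<le> e n * l2norm f" by (intro mult_right_mono cauchy that) simp
    finally show ?thesis by (simp add: op_sub_def)
  qed
  have dl: "(\<lambda>x. X m f x - X n f x) \<in> l2" if "f \<in> l2" for m n f
    by (rule l2_diff(1)[OF bop_l2[OF b that] bop_l2[OF b that]])
  have conv: "convergent (\<lambda>m. X m f x)" for f x
  proof (cases "f \<in> l2")
    case True
    have "(\<lambda>n. e n * l2norm f) \<longlonglongrightarrow> 0" using tendsto_mult_left_zero[OF e] by simp
    have "Cauchy (\<lambda>m. X m f x)"
    proof (rule metric_CauchyI)
      fix \<epsilon> :: real assume "\<epsilon> > 0"
      then have "\<forall>\<^sub>F n in sequentially. e n * l2norm f < \<epsilon> / 2"
        using \<open>(\<lambda>n. e n * l2norm f) \<longlonglongrightarrow> 0\<close> by (intro order_tendstoD(2)) auto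
      then obtain n where n: "e n * l2norm f < \<epsilon> / 2" by (auto simp: eventually_sequentially)
      have *: "dist (X m f x) (X n f x) < \<epsilon> / 2" if "m \<ge> n" for m
        using cmod_le_l2norm[OF dl[OF True, of m n], of x] d[OF that True] n by (simp add: dist_norm)
      have "dist (X k f x) (X l f x) < \<epsilon>" if "k \<ge> n" "l \<ge> n" for k l
        using *[OF that(1)] *[OF that(2)] dist_triangle2[of "X k f x" "X l f x" "X n f x"] by linarith
      then show "\<exists>M. \<forall>m\<ge>M. \<forall>n\<ge>M. dist (X m f x) (X n f x) < \<epsilon>" by blast
    qed
    then show ?thesis by (simp add: Cauchy_convergent_iff)
  qed (simp add: bop_not_l2[OF b] convergent_const)
  define L where "L = (\<lambda>f x. lim (\<lambda>m. X m f x))"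
  have L: "(\<lambda>m. X m f x) \<longlonglongrightarrow> L f x" for f x
    unfolding L_def using conv convergent_LIMSEQ_iff by blast
  have bd: "L2_set (\<lambda>x. cmod (L f x - X n f x)) F \<le> e n * l2norm f" if f: "f \<in> l2" for f n F
  proof (rule tendsto_upperbound)
    show "(\<lambda>m. L2_set (\<lambda>x. cmod (X m f x - X n f x)) F) \<longlonglongrightarrow> L2_set (\<lambda>x. cmod (L f x - X n f x)) F"
      unfolding L2_set_def by (intro tendsto_intros L)
    show "\<forall>\<^sub>F m in sequentially. L2_set (\<lambda>x. cmod (X m f x - X n f x)) F \<le> e n * l2norm f"
      using eventually_ge_at_top[of n]
      by eventually_elim (rule order_trans[OF L2_set_le_l2norm[OF dl[OF f]] d[OF _ f]])
  qed simp
  have LX: "(\<lambda>x. L f x - X n f x) \<in> l2" "l2norm (\<lambda>x. L f x - X n f x) \<le> e n * l2norm f"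
    if "f \<in> l2" for f n using l2_bound[OF bd[OF that]] by auto
  have Le: "L f = (\<lambda>x. (L f x - X 0 f x) + X 0 f x)" for f by simp
  have Lb: "L \<in> bop"
  proof (rule bopI[where K = "e 0 + opnorm (X 0)"])
    show "L f \<in> l2" if "f \<in> l2" for f
      by (subst Le) (rule l2_add(1)[OF LX(1)[OF that] bop_l2[OF b that]])
    show "L f = (\<lambda>_. 0)" if "f \<notin> l2" for f
      using L[of f] by (simp add: bop_not_l2[OF b that] LIMSEQ_const_iff fun_eq_iff)
    show "L (\<lambda>x. f x + g x) = (\<lambda>x. L f x + L g x)" if "f \<in> l2" "g \<in> l2" for f g
    proof
      fix x
      have "(\<lambda>m. X m (\<lambda>x. f x + g x) x) \<longlonglongrightarrow> L f x + L g x"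
        unfolding bop_add[OF b that] by (intro tendsto_add L)
      then show "L (\<lambda>x. f x + g x) x = L f x + L g x" using L LIMSEQ_unique by blast
    qed
    show "L (\<lambda>x. c * f x) = (\<lambda>x. c * L f x)" if "f \<in> l2" for f c
    proof
      fix x
      have "(\<lambda>m. X m (\<lambda>x. c * f x) x) \<longlonglongrightarrow> c * L f x"
        unfolding bop_scale[OF b that] by (intro tendsto_mult_left L)
      then show "L (\<lambda>x. c * f x) x = c * L f x" using L LIMSEQ_unique by blast
    qed
    show "l2norm (L f) \<le> (e 0 + opnorm (X 0)) * l2norm f" if "f \<in> l2" for f
      using l2_add(2)[OF LX(1)[OF that, of 0] bop_l2[OF b that, of 0]] LX(2)[OF that, of 0]
        opnorm_bound[OF b that, of 0] by (simp add: algebra_simps)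
  qed
  have n: "opnorm (op_sub L (X n)) \<le> e n" for n
    by (rule opnorm_le) (auto simp: op_sub_def LX e0)
  have "L \<in> roe"
  proof (rule roe_closed[OF Lb])
    fix \<epsilon> :: real assume "\<epsilon> > 0"
    then have "\<forall>\<^sub>F n in sequentially. e n < \<epsilon>" using e by (intro order_tendstoD(2)) auto
    then obtain k where "e k < \<epsilon>" by (auto simp: eventually_sequentially)
    then show "\<exists>S\<in>roe. opnorm (op_sub L S) < \<epsilon>" using n[of k] X[of k] by (intro bexI[of _ "X k"]) auto
  qed
  then show ?thesis using n by blast
qed

section \<open>Square roots by a contraction argument\<close>

lemma bop_eq_of_opnorm:
  assumes "T \<in> bop" "S \<in> bop" "opnorm (op_sub T S) \<le> 0" shows "T = S"
proof (rule bop_eqI[OF assms(1,2)])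
  fix f :: "'a vec" assume f: "f \<in> l2"
  have D: "op_sub T S \<in> bop" by (intro bop_op_sub assms)
  have "l2norm (op_sub T S f) \<le> opnorm (op_sub T S) * l2norm f" by (rule opnorm_bound[OF D f])
  also have "\<dots> \<le> 0" using assms(3) by (simp add: mult_nonpos_nonneg)
  finally have "op_sub T S f = (\<lambda>_. 0)"
    using l2norm_eq_0[OF bop_l2[OF D f]] l2norm_nonneg[of "op_sub T S f"] by linarith
  then show "T f = S f" by (simp add: op_sub_def fun_eq_iff)
qed

text \<open>Since XX - YY = X(X - Y) + (X - Y)Y, the map sending y to (c + yy)/2 has Lipschitz
  constant \<open>M\<close> on the ball of radius \<open>M\<close>. The value 1/2 gives the
  contraction; a cruder value suffices to see that the limit is a fixed point.\<close>

lemma opnorm_le_half_square: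
  assumes "X \<in> bop" "Y \<in> bop" "c \<in> bop" "opnorm X \<le> M" "opnorm Y \<le> M"
  shows "opnorm (op_sub (op_scale (1/2) (op_add c (X \<circ> X))) (op_scale (1/2) (op_add c (Y \<circ> Y))))
     \<le> M * opnorm (op_sub X Y)"
proof -
  let ?d = "op_sub X Y"
  have d: "?d \<in> bop" by (intro bop_op_sub assms)
  have eq: "op_sub (op_scale (1/2) (op_add c (X \<circ> X))) (op_scale (1/2) (op_add c (Y \<circ> Y)))
    = op_scale (1/2) (op_sub (X \<circ> X) (Y \<circ> Y))"
    by (auto simp: op_sub_def op_scale_def op_add_def fun_eq_iff field_simps)
  have "opnorm (op_scale (1/2) (op_sub (X \<circ> X) (Y \<circ> Y))) \<le> cmod (1/2) * opnorm (op_sub (X \<circ> X) (Y \<circ> Y))"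
    by (intro bop_op_scale bop_op_sub bop_comp assms)
  moreover have "opnorm (op_sub (X \<circ> X) (Y \<circ> Y)) \<le> opnorm X * opnorm ?d + opnorm ?d * opnorm Y"
    by (intro opnorm_comp_sub_le assms)
  moreover have "opnorm X * opnorm ?d \<le> M * opnorm ?d" "opnorm ?d * opnorm Y \<le> opnorm ?d * M"
    by (intro mult_right_mono mult_left_mono opnorm_nonneg assms d)+
  ultimately show ?thesis unfolding eq by (simp add: mult.commute)
qed

text \<open>The square root is \<open>1 - y\<close>, where \<open>y\<close> is the fixed point of \<open>y \<mapsto> (c + y\<^sup>2) / 2\<close>.\<close>
lemma roe_sqrt_ident_minus:
  fixes c :: "('a::metric_space) op"
  assumes u: "ulf TYPE('a)" and c: "c \<in> roe" "adj c = c" "opnorm c \<le> 1/2"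
  shows "\<exists>b\<in>roe. adj b = b \<and> b \<circ> b = op_sub ident c"
proof -
  define \<Phi> where "\<Phi> = (\<lambda>y. op_scale (1/2) (op_add c (y \<circ> y)))"
  note cb = roe_bop[OF c(1)]
  have \<Phi>_roe: "\<Phi> y \<in> roe" if "y \<in> roe" for y
    unfolding \<Phi>_def by (intro roe_op_scale roe_op_add roe_comp u c that)
  have \<Phi>_adj: "adj (\<Phi> y) = \<Phi> y" if "y \<in> bop" "adj y = y" for y
    unfolding \<Phi>_def by (simp add: adj_op_scale adj_op_add adj_comp bop_op_add bop_comp cb that c)
  \<comment> \<open>The ball of radius 1/2 is invariant, as (1/2 + 1/4)/2 is at most 1/2.\<close>
  have \<Phi>_norm: "opnorm (\<Phi> y) \<le> 1/2" if "y \<in> bop" "opnorm y \<le> 1/2" for y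
  proof -
    have "opnorm (\<Phi> y) \<le> cmod (1/2) * opnorm (op_add c (y \<circ> y))"
      unfolding \<Phi>_def by (intro bop_op_scale bop_op_add bop_comp cb that)
    moreover have "opnorm (op_add c (y \<circ> y)) \<le> opnorm c + opnorm (y \<circ> y)"
      by (intro bop_op_add bop_comp cb that)
    moreover have "opnorm (y \<circ> y) \<le> opnorm y * opnorm y" by (intro bop_comp that)
    moreover have "opnorm y * opnorm y \<le> 1/2 * (1/2)"
      by (intro mult_mono that opnorm_nonneg) auto
    ultimately show ?thesis using c(3) by simp
  qed
  \<comment> \<open>The iteration starts at the zero operator, written as
    \<open>op_scale 0 c\<close> so that its membership and self-adjointness come from those of
    \<open>c\<close>.\<close>
  define Y where "Y = (\<lambda>n. (\<Phi> ^^ n) (op_scale 0 c))"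
  have YS: "Y (Suc n) = \<Phi> (Y n)" for n by (simp add: Y_def)
  have Y: "Y n \<in> roe \<and> adj (Y n) = Y n \<and> opnorm (Y n) \<le> 1/2" for n
  proof (induction n)
    case 0
    have "opnorm (op_scale 0 c) \<le> cmod 0 * opnorm c" by (intro bop_op_scale cb)
    then show ?case using c cb by (simp add: Y_def roe_op_scale adj_op_scale)
  next
    case (Suc n)
    then show ?case unfolding YS using \<Phi>_roe \<Phi>_adj \<Phi>_norm roe_bop by blast
  qed
  note Yb = roe_bop[OF Y[THEN conjunct1]]
  have step: "opnorm (op_sub (Y (Suc n)) (Y n)) \<le> (1/2)^n" for n
  proof (induction n)
    case 0
    have "opnorm (op_sub (Y (Suc 0)) (Y 0)) \<le> opnorm (Y (Suc 0)) + opnorm (Y 0)"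
      by (intro bop_op_sub Yb)
    then show ?case using Y[of 0] Y[of "Suc 0"] by simp
  next
    case (Suc n)
    have "opnorm (op_sub (Y (Suc (Suc n))) (Y (Suc n))) \<le> 1/2 * opnorm (op_sub (Y (Suc n)) (Y n))"
      using opnorm_le_half_square[OF Yb Yb cb, of "Suc n" "1/2" n] Y[of "Suc n"] Y[of n]
      unfolding YS \<Phi>_def by simp
    then show ?case using Suc by simp
  qed
  have cauchy: "opnorm (op_sub (Y m) (Y n)) \<le> 2 * (1/2)^n" if "n \<le> m" for m n
  proof -
    \<comment> \<open>The subtracted term is the part of the geometric series not yet used; it lets
      the induction close.\<close>
    have "opnorm (op_sub (Y (n + k)) (Y n)) \<le> 2 * (1/2)^n - 2 * (1/2)^(n+k)" for k
    proof (induction k)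
      case 0
      have "opnorm (op_sub (Y n) (Y n)) \<le> 0" by (rule opnorm_le) (auto simp: op_sub_def)
      then show ?case by simp
    next
      case (Suc k)
      have "opnorm (op_sub (Y (n + Suc k)) (Y n))
          \<le> opnorm (op_sub (Y (Suc (n + k))) (Y (n + k))) + opnorm (op_sub (Y (n + k)) (Y n))"
        using opnorm_op_sub_triangle[OF Yb Yb Yb] by simp
      then show ?case using Suc step[of "n + k"] by simp
    qed
    from this[of "m - n"] have "opnorm (op_sub (Y m) (Y n)) \<le> 2 * (1/2)^n - 2 * (1/2)^m"
      using that by simp
    moreover have "(1/2 :: real)^m \<ge> 0" by simp
    ultimately show ?thesis by linarith
  qed
  have lim: "(\<lambda>n. 2 * (1/2)^n :: real) \<longlonglongrightarrow> 0"
    by (rule tendsto_mult_right_zero) (rule LIMSEQ_power_zero, simp)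
  obtain L where L: "L \<in> roe" "\<And>n. opnorm (op_sub L (Y n)) \<le> 2 * (1/2)^n"
    using roe_complete[OF Y[THEN conjunct1] lim cauchy] by blast
  note Lb = roe_bop[OF L(1)]
  have Ln: "opnorm L \<le> 3"
  proof -
    have "L = op_add (op_sub L (Y 0)) (Y 0)" by (auto simp: op_add_def op_sub_def)
    then have "opnorm L \<le> opnorm (op_sub L (Y 0)) + opnorm (Y 0)"
      using bop_op_add(2)[OF bop_op_sub(1)[OF Lb Yb] Yb] by metis
    then show ?thesis using L(2)[of 0] Y[of 0] by simp
  qed
  have "adj L = L"
  proof (rule bop_eq_of_opnorm[OF adj_bop[OF Lb] Lb])
    have "opnorm (op_sub (adj L) L) \<le> 2 * (2 * (1/2)^n)" for n
    proof -
      have "opnorm (op_sub (adj L) L) \<le> opnorm (op_sub (adj L) (Y n)) + opnorm (op_sub (Y n) L)"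
        by (intro opnorm_op_sub_triangle adj_bop Lb Yb)
      moreover have "opnorm (op_sub (adj L) (Y n)) \<le> opnorm (op_sub L (Y n))"
        using opnorm_adj_le[OF bop_op_sub(1)[OF Lb Yb], of n] Y[of n] adj_op_sub[OF Lb Yb, of n] by simp
      ultimately show ?thesis using L(2)[of n] opnorm_op_sub_commute[of "Y n" L] by simp
    qed
    then show "opnorm (op_sub (adj L) L) \<le> 0"
      by (intro tendsto_lowerbound[OF tendsto_mult_right_zero[OF lim, of 2]]) auto
  qed
  have fix_L: "L = \<Phi> L"
  proof (rule bop_eq_of_opnorm[OF Lb roe_bop[OF \<Phi>_roe[OF L(1)]]])
    \<comment> \<open>The distance to \<open>Y (Suc n)\<close> contributes (1/2)^n and the Lipschitz
      bound with constant 3 contributes 6 (1/2)^n, rounded up to 8 in total.\<close>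
    have "opnorm (op_sub L (\<Phi> L)) \<le> 4 * (2 * (1/2)^n)" for n
    proof -
      have "opnorm (op_sub L (\<Phi> L)) \<le> opnorm (op_sub L (Y (Suc n))) + opnorm (op_sub (Y (Suc n)) (\<Phi> L))"
        by (intro opnorm_op_sub_triangle Lb Yb roe_bop \<Phi>_roe L)
      moreover have "opnorm (op_sub (Y (Suc n)) (\<Phi> L)) \<le> 3 * opnorm (op_sub (Y n) L)"
        unfolding YS \<Phi>_def by (rule opnorm_le_half_square) (use Yb Lb cb Ln Y[of n] in auto)
      moreover have "2 * (1/2) ^ Suc n = (1/2 :: real) ^ n" "(1/2 :: real) ^ n \<ge> 0" by simp_all
      ultimately show ?thesis
        using L(2)[of n] L(2)[of "Suc n"] opnorm_op_sub_commute[of "Y n" L] by linarith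
    qed
    then show "opnorm (op_sub L (\<Phi> L)) \<le> 0"
      by (intro tendsto_lowerbound[OF tendsto_mult_right_zero[OF lim, of 4]]) auto
  qed
  \<comment> \<open>The fixed point equation solved for \<open>c\<close>; it says that (1 - L)(1 -
    L) = 1 - c.\<close>
  have cL: "c f x = 2 * L f x - L (L f) x" for f x
    using fun_cong[OF fun_cong[OF fix_L, of f], of x]
    by (simp add: \<Phi>_def op_scale_def op_add_def field_simps)
  define b where "b = op_sub ident L"
  have "b \<circ> b = op_sub ident c"
  proof (rule bop_eqI)
    fix f :: "'a vec" assume f: "f \<in> l2"
    have "b f \<in> l2" unfolding b_def by (rule bop_l2[OF bop_op_sub(1)[OF ident_bop Lb] f])
    then show "(b \<circ> b) f = op_sub ident c f"
      using f by (simp add: b_def op_sub_def ident_def cL bop_diff[OF Lb f bop_l2[OF Lb f]] fun_eq_iff)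
  qed (auto simp: b_def intro!: bop_comp bop_op_sub ident_bop Lb cb)
  moreover have "adj b = b"
    unfolding b_def by (simp add: adj_op_sub adj_ident ident_bop Lb \<open>adj L = L\<close>)
  moreover have "b \<in> roe" unfolding b_def by (intro roe_op_sub roe_ident L)
  ultimately show ?thesis by blast
qed

subsection \<open>States\<close>

lemma qstate_add: "qstate \<psi> \<Longrightarrow> a \<in> roe \<Longrightarrow> b \<in> roe \<Longrightarrow> \<psi> (op_add a b) = \<psi> a + \<psi> b"
  and qstate_scale: "qstate \<psi> \<Longrightarrow> a \<in> roe \<Longrightarrow> \<psi> (op_scale c a) = c * \<psi> a"
  and qstate_pos: "qstate \<psi> \<Longrightarrow> a \<in> roe \<Longrightarrow> \<psi> (adj a \<circ> a) \<in> \<real> \<and> Re (\<psi> (adj a \<circ> a)) \<ge> 0"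
  and qstate_ident: "qstate \<psi> \<Longrightarrow> \<psi> ident = 1"
  and qstate_compact: "qstate \<psi> \<Longrightarrow> K \<in> compact_ops \<Longrightarrow> \<psi> K = 0"
  by (auto simp: qstate_def)

lemma qstate_sub: "qstate \<psi> \<Longrightarrow> a \<in> roe \<Longrightarrow> b \<in> roe \<Longrightarrow> \<psi> (op_sub a b) = \<psi> a - \<psi> b"
  by (simp add: op_sub_conv qstate_add qstate_scale roe_op_scale)

lemma qstate_eq_mod_compact:
  "qstate \<psi> \<Longrightarrow> a \<in> roe \<Longrightarrow> b \<in> roe \<Longrightarrow> op_sub a b \<in> compact_ops \<Longrightarrow> \<psi> a = \<psi> b"
  using qstate_sub[of \<psi> a b] qstate_compact[of \<psi> "op_sub a b"] by simp

text \<open>Positivity is applied to \<open>a\<close> plus a scalar \<open>l\<close>. The values 0,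
  1 and \<i> force \<open>\<psi> (adj a) = cnj (\<psi> a)\<close>, which is not a clause of
  \<open>qstate\<close>; then \<open>l = - \<psi> a\<close> is the minimising choice.\<close>

lemma qstate_cauchy_schwarz:
  fixes \<psi> :: "('a::metric_space) op \<Rightarrow> complex"
  assumes u: "ulf TYPE('a)" and q: "qstate \<psi>" and a: "a \<in> roe"
  shows "(cmod (\<psi> a))\<^sup>2 \<le> Re (\<psi> (adj a \<circ> a))"
proof -
  note b = roe_bop[OF a]
  have pos: "Im (\<psi> (adj a \<circ> a) + l * \<psi> (adj a) + cnj l * \<psi> a + cnj l * l) = 0 \<and>
    Re (\<psi> (adj a \<circ> a) + l * \<psi> (adj a) + cnj l * \<psi> a + cnj l * l) \<ge> 0" for l
  proof -
    let ?s = "op_add a (op_scale l ident)"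
    have s: "?s \<in> roe" by (intro roe_op_add roe_op_scale roe_ident a)
    have "adj ?s \<circ> ?s = op_add (op_add (op_add (adj a \<circ> a) (op_scale l (adj a))) (op_scale (cnj l) a))
        (op_scale (cnj l * l) ident)"
      by (simp add: adj_op_add adj_op_scale b bop_op_scale ident_bop adj_ident
          comp_op_add_left comp_op_scale_left comp_op_add_right comp_op_scale_right adj_bop comp_ident bop_op_add)
        (auto simp: op_add_def op_scale_def algebra_simps)
    then have "\<psi> (adj ?s \<circ> ?s) = \<psi> (adj a \<circ> a) + l * \<psi> (adj a) + cnj l * \<psi> a + cnj l * l"
      by (simp add: qstate_add[OF q] qstate_scale[OF q] qstate_ident[OF q] roe_op_add roe_op_scale
          roe_comp[OF u] roe_adj a roe_ident)
    then show ?thesis using qstate_pos[OF q s] by (metis complex_is_Real_iff)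
  qed
  have 0: "Im (\<psi> (adj a \<circ> a)) = 0" using pos[of 0] by simp
  have "\<psi> (adj a) = cnj (\<psi> a)"
    using pos[of 1] pos[of \<i>] 0 by (simp add: complex_eq_iff)
  then show ?thesis using pos[of "- \<psi> a"]
    by (simp add: cmod_power2) (simp add: power2_eq_square)
qed

text \<open>The operator order is not directly accessible to \<psi>, so 1 - t (adj a) a is exhibited
  as a square inside the Roe algebra. Its positivity bounds
  \<open>Re (\<psi> (adj a \<circ> a))\<close> by 1/t, and Cauchy-Schwarz does the rest. For
  compactness any bound depending only on \<open>a\<close> will do, hence the generous
  constants.\<close>

lemma qstate_bound:
  fixes \<psi> :: "('a::metric_space) op \<Rightarrow> complex"
  assumes u: "ulf TYPE('a)" and q: "qstate \<psi>" and a: "a \<in> roe"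
  shows "cmod (\<psi> a) \<le> 2 * (opnorm a + 1)"
proof -
  note b = roe_bop[OF a]
  define M where "M = opnorm a + 1"
  have M: "M > 0" using opnorm_nonneg[OF b] by (simp add: M_def)
  \<comment> \<open>As \<open>opnorm (adj a \<circ> a)\<close> is at most M^2, this brings
    \<open>c\<close> to norm at most 1/2, the range in which the square root exists.\<close>
  define t where "t = 1 / (2 * M\<^sup>2)"
  have t: "t > 0" using M by (simp add: t_def)
  let ?p = "adj a \<circ> a"
  define c where "c = op_scale (of_real t) ?p"
  have p: "?p \<in> roe" by (intro roe_comp u roe_adj a)
  have cr: "c \<in> roe" unfolding c_def by (intro roe_op_scale p)
  have "adj c = c" unfolding c_def
    by (simp add: adj_op_scale bop_comp adj_bop b adj_comp adj_adj)
  moreover have "opnorm c \<le> 1/2"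
  proof -
    have "opnorm c \<le> cmod (of_real t) * opnorm ?p" unfolding c_def by (intro bop_op_scale roe_bop p)
    then have "opnorm c \<le> t * opnorm ?p" using t by simp
    moreover have 1: "opnorm ?p \<le> opnorm (adj a) * opnorm a" by (intro bop_comp adj_bop b)
    have 2: "opnorm (adj a) * opnorm a \<le> M * M"
      using opnorm_adj_le[OF b] by (intro mult_mono opnorm_nonneg b adj_bop) (use M in \<open>auto simp: M_def\<close>)
    moreover have "t * opnorm ?p \<le> t * (M * M)" using 1 2 t by (intro mult_left_mono) auto
    ultimately have "opnorm c \<le> t * (M * M)" by linarith
    then show ?thesis using M by (simp add: t_def power2_eq_square)
  qed
  ultimately obtain s where s: "s \<in> roe" "adj s = s" "s \<circ> s = op_sub ident c"
    using roe_sqrt_ident_minus[OF u cr] by blast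
  have "\<psi> (op_sub ident c) = 1 - of_real t * \<psi> ?p"
    unfolding c_def by (simp add: qstate_sub[OF q] roe_ident roe_op_scale p qstate_ident[OF q] qstate_scale[OF q])
  then have "t * Re (\<psi> ?p) \<le> 1" using qstate_pos[OF q s(1)] s by simp
  then have "Re (\<psi> ?p) \<le> 2 * M\<^sup>2" using M by (simp add: t_def field_simps)
  also have "\<dots> \<le> (2 * M)\<^sup>2" by (simp add: power2_eq_square)
  finally have "(cmod (\<psi> a))\<^sup>2 \<le> (2 * M)\<^sup>2" using qstate_cauchy_schwarz[OF u q a] by linarith
  then have "cmod (\<psi> a) \<le> 2 * M" by (rule power2_le_imp_le) (use M in simp)
  then show ?thesis by (simp add: M_def)
qed

subsection \<open>Reweighting KMS states by Higson functions\<close>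

lemma higson_bounded: "higson f \<Longrightarrow> bounded (range f)"
  by (simp add: higson_def)

text \<open>The oscillation of \<open>g\<close> is controlled by that of \<open>f\<close>, and
  boundedness follows by comparison with one base point. This covers real and imaginary parts,
  affine images, and square roots away from 0.\<close>

lemma higson_lipschitz:
  assumes "higson f" "L > 0" "\<And>x y. cmod (g x - g y) \<le> L * cmod (f x - f y)"
  shows "higson g"
proof -
  fix z :: 'a
  obtain B where B: "\<And>x. cmod (f x) \<le> B" using assms(1) by (auto simp: higson_def bounded_iff)
  have "cmod (g x) \<le> cmod (g z) + L * (B + B)" for x
  proof -
    have "cmod (g x - g z) \<le> L * (B + B)"
      using assms(3)[of x z] norm_triangle_ineq4[of "f x" "f z"] B[of x] B[of z] assms(2)
      by (smt (verit) mult_left_mono)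
    then show ?thesis using norm_triangle_sub[of "g x" "g z"] by linarith
  qed
  then have "bounded (range g)" by (auto simp: bounded_iff)
  moreover have "\<exists>F. finite F \<and> (\<forall>x y. x \<notin> F \<and> y \<notin> F \<and> dist x y < R \<longrightarrow> cmod (g x - g y) < \<epsilon>)"
    if e: "\<epsilon> > 0" and R: "R > 0" for \<epsilon> R
  proof -
    have "\<epsilon> / L > 0" using e assms(2) by simp
    then obtain F where F: "finite F" "\<And>x y. x \<notin> F \<and> y \<notin> F \<and> dist x y < R \<Longrightarrow> cmod (f x - f y) < \<epsilon> / L"
      using assms(1) R unfolding higson_def by meson
    have "cmod (g x - g y) < \<epsilon>" if "x \<notin> F \<and> y \<notin> F \<and> dist x y < R" for x y
      using F(2)[OF that] assms(3)[of x y] assms(2) by (simp add: field_simps)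
    then show ?thesis using F(1) by blast
  qed
  ultimately show ?thesis by (simp add: higson_def)
qed

text \<open>The two arguments differ by a commutator multiplied by \<open>b\<close> on one side,
  which is compact and so invisible to \<psi>.\<close>

lemma qstate_commute_higson:
  fixes \<psi> :: "('a::metric_space) op \<Rightarrow> complex"
  assumes u: "ulf TYPE('a)" and q: "qstate \<psi>" and f: "higson f" and a: "a \<in> roe" and b: "b \<in> roe"
  shows "\<psi> (mult_op f \<circ> a \<circ> b) = \<psi> (a \<circ> mult_op f \<circ> b)" "\<psi> (b \<circ> (mult_op f \<circ> a)) = \<psi> (b \<circ> (a \<circ> mult_op f))"
proof -
  note m = roe_mult_op[OF higson_bounded[OF f]]
  note K = commutator_compact[OF u f a]
  show "\<psi> (mult_op f \<circ> a \<circ> b) = \<psi> (a \<circ> mult_op f \<circ> b)"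
  proof (rule qstate_eq_mod_compact[OF q])
    show "op_sub (mult_op f \<circ> a \<circ> b) (a \<circ> mult_op f \<circ> b) \<in> compact_ops"
      using compact_comp_right[OF K roe_bop[OF b]] by (simp add: commutator_def comp_op_sub_left)
  qed (intro roe_comp u m a b)+
  show "\<psi> (b \<circ> (mult_op f \<circ> a)) = \<psi> (b \<circ> (a \<circ> mult_op f))"
  proof (rule qstate_eq_mod_compact[OF q])
    show "op_sub (b \<circ> (mult_op f \<circ> a)) (b \<circ> (a \<circ> mult_op f)) \<in> compact_ops"
      using compact_comp_left[OF K roe_bop[OF b]] unfolding commutator_def
      by (subst (asm) comp_op_sub_right) (simp_all add: bop_comp roe_bop m a b)
  qed (intro roe_comp u m a b)+
qed

text \<open>The pointwise square root is bounded, and every bounded diagonal operator lies in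
  \<open>roe\<close>, so the operator is a square there.\<close>

lemma qstate_mult_op_nonneg:
  fixes \<psi> :: "('a::metric_space) op \<Rightarrow> complex"
  assumes q: "qstate \<psi>" and m: "bounded (range m)" "\<And>x. 0 \<le> m x"
  shows "\<psi> (mult_op (\<lambda>x. of_real (m x))) \<in> \<real>" "Re (\<psi> (mult_op (\<lambda>x. of_real (m x)))) \<ge> 0"
proof -
  let ?r = "\<lambda>x. complex_of_real (sqrt (m x))"
  obtain B where B: "\<And>x. \<bar>m x\<bar> \<le> B" using m(1) by (auto simp: bounded_iff)
  have "cmod (?r x) \<le> sqrt B" for x using B[of x] m(2)[of x] by simp
  then have r: "bounded (range ?r)" by (auto simp: bounded_iff)
  have "adj (mult_op ?r) \<circ> mult_op ?r = mult_op (\<lambda>x. of_real (m x))"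
    by (simp add: adj_mult_op[OF r] mult_op_comp[OF r] of_real_mult[symmetric] m(2) del: of_real_mult)
  then show "\<psi> (mult_op (\<lambda>x. of_real (m x))) \<in> \<real>" "Re (\<psi> (mult_op (\<lambda>x. of_real (m x)))) \<ge> 0"
    using qstate_pos[OF q roe_mult_op[OF r]] by simp_all
qed

text \<open>The analogue of passing from a measure to the normalised measure with density
  \<open>w\<close>; of interest when \<open>\<psi> (mult_op w)\<close> is nonzero.\<close>

definition reweight :: "('a op \<Rightarrow> complex) \<Rightarrow> 'a vec \<Rightarrow> 'a op \<Rightarrow> complex" where
  "reweight \<psi> w a = \<psi> (mult_op w \<circ> a) / \<psi> (mult_op w)"

lemma kms_reweight:
  fixes h :: "'a::metric_space \<Rightarrow> real"
  assumes u: "ulf TYPE('a)" and k: "kms h \<beta> \<psi>"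
    and g: "higson (\<lambda>x. of_real (g x))" and w: "higson w" "w = (\<lambda>x. of_real ((g x)\<^sup>2))"
    and nz: "\<psi> (mult_op w) \<noteq> 0"
  shows "kms h \<beta> (reweight \<psi> w)"
proof -
  have q: "qstate \<psi>" using k by (simp add: kms_def)
  let ?G = "mult_op (\<lambda>x. complex_of_real (g x))"
  let ?W = "mult_op w"
  note bg = higson_bounded[OF g] and bw = higson_bounded[OF w(1)]
  note G = roe_mult_op[OF bg] and W = roe_mult_op[OF bw]
  have WG: "?W = ?G \<circ> ?G" unfolding mult_op_comp[OF bg] w(2) by (simp add: power2_eq_square)
  have adjG: "adj ?G = ?G" using adj_mult_op[OF bg] by simp
  have pos: "\<psi> (?W \<circ> (adj a \<circ> a)) \<in> \<real> \<and> Re (\<psi> (?W \<circ> (adj a \<circ> a))) \<ge> 0" if a: "a \<in> roe" for a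
  proof -
    have p: "adj a \<circ> a \<in> roe" by (intro roe_comp u roe_adj a)
    have "?W \<circ> (adj a \<circ> a) = ?G \<circ> (?G \<circ> (adj a \<circ> a))" by (simp add: WG o_assoc)
    \<comment> \<open>One of the two factors of the weight goes to the far right, which makes the
      argument symmetric.\<close>
    moreover have "\<psi> (?G \<circ> (?G \<circ> (adj a \<circ> a))) = \<psi> (?G \<circ> ((adj a \<circ> a) \<circ> ?G))"
      by (rule qstate_commute_higson(2)[OF u q g p G])
    moreover have "?G \<circ> ((adj a \<circ> a) \<circ> ?G) = adj (a \<circ> ?G) \<circ> (a \<circ> ?G)"
      by (simp add: adj_comp roe_bop a G adjG o_assoc)
    ultimately show ?thesis using qstate_pos[OF q roe_comp[OF u a G]] by (simp only:)
  qed
  \<comment> \<open>The case \<open>a = ident\<close>: the normalising constant is real and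
    nonnegative, so dividing by it preserves positivity.\<close>
  have "\<psi> ?W \<in> \<real> \<and> Re (\<psi> ?W) \<ge> 0"
    using pos[OF roe_ident] by (simp add: adj_ident comp_ident ident_bop roe_bop W)
  then obtain s where s: "\<psi> ?W = of_real s" "s \<ge> 0" by (auto elim: Reals_cases)
  have "qstate (reweight \<psi> w)"
    unfolding qstate_def
  proof (intro conjI ballI allI)
    show "reweight \<psi> w (op_add a b) = reweight \<psi> w a + reweight \<psi> w b" if "a \<in> roe" "b \<in> roe" for a b
      using that by (simp add: reweight_def comp_op_add_right roe_bop W qstate_add[OF q] roe_comp[OF u] add_divide_distrib)
    show "reweight \<psi> w (op_scale c a) = c * reweight \<psi> w a" if "a \<in> roe" for a c
      using that by (simp add: reweight_def comp_op_scale_right roe_bop W qstate_scale[OF q] roe_comp[OF u])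
    show "reweight \<psi> w (adj a \<circ> a) \<in> \<real>" if "a \<in> roe" for a
      using pos[OF that] s by (simp add: reweight_def Reals_divide)
    show "0 \<le> Re (reweight \<psi> w (adj a \<circ> a))" if "a \<in> roe" for a
      using pos[OF that] s by (simp add: reweight_def Re_divide_of_real)
    show "reweight \<psi> w ident = 1"
      using nz by (simp add: reweight_def comp_ident roe_bop W)
    show "reweight \<psi> w K = 0" if "K \<in> compact_ops" for K
      using qstate_compact[OF q compact_comp_left[OF that roe_bop[OF W]]] by (simp add: reweight_def)
  qed
  moreover have "reweight \<psi> w (a \<circ> F (\<i> * of_real \<beta>)) = reweight \<psi> w (b \<circ> a)"
    if a: "a \<in> roe" and b: "b \<in> roe" and F: "analytic_lift h b F" for a b F
  proof -
    have "\<psi> (?W \<circ> (a \<circ> F (\<i> * of_real \<beta>))) = \<psi> ((?W \<circ> a) \<circ> F (\<i> * of_real \<beta>))"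
      by (simp add: o_assoc)
    \<comment> \<open>The KMS identity of \<psi> is applied to \<open>?W \<circ> a\<close> in place
      of \<open>a\<close>; the weight is then moved past \<open>b\<close>.\<close>
    also have "\<dots> = \<psi> (b \<circ> (?W \<circ> a))"
      using k roe_comp[OF u W a] b F unfolding kms_def by blast
    also have "\<dots> = \<psi> (b \<circ> ?W \<circ> a)" by (simp add: o_assoc)
    also have "\<dots> = \<psi> (?W \<circ> b \<circ> a)" by (rule qstate_commute_higson(1)[OF u q w(1) b a, symmetric])
    also have "\<dots> = \<psi> (?W \<circ> (b \<circ> a))" by (simp add: o_assoc)
    finally show ?thesis by (simp add: reweight_def)
  qed
  ultimately show ?thesis by (auto simp: kms_def)
qed

subsection \<open>Extreme KMS states are multiplicative on Higson functions\<close>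

text \<open>The two reweighted states average back to \<psi>, so extremality equates the first with
  \<psi>, that is \<psi>(w a) = \<psi>(w) \<psi>(a). Both sides are affine in \<open>f\<close> with
  the same constant term, which leaves the identity for \<open>f\<close>.\<close>

lemma extreme_kms_mult_real:
  fixes h :: "'a::metric_space \<Rightarrow> real"
  assumes u: "ulf TYPE('a)" and e: "extreme_kms h \<beta> \<psi>" and f: "higson (\<lambda>x. complex_of_real (f x))"
    and a: "a \<in> roe"
  shows "\<psi> (mult_op (\<lambda>x. of_real (f x)) \<circ> a) = \<psi> (mult_op (\<lambda>x. of_real (f x))) * \<psi> a"
proof -
  have k: "kms h \<beta> \<psi>" using e by (simp add: extreme_kms_def)
  then have q: "qstate \<psi>" by (simp add: kms_def)
  obtain B where B: "\<And>x. \<bar>f x\<bar> \<le> B" using f by (auto simp: higson_def bounded_iff)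
  define M where "M = \<bar>B\<bar> + 1"
  have M: "M > 0" "\<bar>f x\<bar> \<le> M" for x using B[of x] by (auto simp: M_def)
  \<comment> \<open>The weights for c = 1 and c = -1 add up to 1, and since \<open>M\<close> bounds
    |f| their values stay within 1/4 of 1/2.\<close>
  define v where "v = (\<lambda>c x. 1/2 + c * f x / (4 * M))"
  have v: "1/4 \<le> v c x" "v c x \<le> 3/4" if "c = 1 \<or> c = -1" for c x
    using that M(1) M(2)[of x] by (auto simp: v_def field_simps abs_le_iff)
  define w where "w = (\<lambda>c x. complex_of_real (v c x))"
  have hw: "higson (w c)" if "c = 1 \<or> c = -1" for c
  proof (rule higson_lipschitz[OF f, of "1 / (4 * M)"])
    have "w c x - w c y = of_real (c / (4 * M)) * (of_real (f x) - of_real (f y))" for x y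
      by (simp add: w_def v_def diff_divide_distrib right_diff_distrib)
    then show "cmod (w c x - w c y) \<le> 1 / (4 * M) * cmod (of_real (f x) - of_real (f y))" for x y
      using that M by (auto simp: norm_mult norm_divide)
  qed (use M in simp)
  have hg: "higson (\<lambda>x. complex_of_real (sqrt (v c x)))" if c: "c = 1 \<or> c = -1" for c
  proof (rule higson_lipschitz[OF hw[OF c], of 1])
    fix x y
    \<comment> \<open>Two such square roots add up to at least 1, so dividing a difference of
      weights by that sum does not increase it.\<close>
    have s: "sqrt (v c z) \<ge> 1/2" for z
      using v(1)[OF c, of z] by (intro real_le_rsqrt) (simp add: power2_eq_square)
    have "v c x - v c y = (sqrt (v c x) - sqrt (v c y)) * (sqrt (v c x) + sqrt (v c y))"
      using v(1)[OF c, of x] v(1)[OF c, of y] by (simp add: algebra_simps)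
    then have "\<bar>v c x - v c y\<bar> = \<bar>sqrt (v c x) - sqrt (v c y)\<bar> * (sqrt (v c x) + sqrt (v c y))"
      using s[of x] s[of y] by (simp add: abs_mult)
    moreover have "\<bar>sqrt (v c x) - sqrt (v c y)\<bar> * 1 \<le> \<bar>sqrt (v c x) - sqrt (v c y)\<bar> * (sqrt (v c x) + sqrt (v c y))"
      using s[of x] s[of y] by (intro mult_left_mono) auto
    ultimately show "cmod (complex_of_real (sqrt (v c x)) - of_real (sqrt (v c y))) \<le> 1 * cmod (w c x - w c y)"
      unfolding w_def of_real_diff[symmetric] norm_of_real by simp
  qed simp
  have sq: "w c = (\<lambda>x. of_real ((sqrt (v c x))\<^sup>2))" if "c = 1 \<or> c = -1" for c
  proof
    fix x
    have "v c x \<ge> 0" using v(1)[OF that, of x] by simp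
    then show "w c x = of_real ((sqrt (v c x))\<^sup>2)" by (simp add: w_def del: of_real_power)
  qed
  let ?m = "\<lambda>c. mult_op (w c)" and ?f = "mult_op (\<lambda>x. of_real (f x))"
  have mr: "?m c \<in> roe" if "c = 1 \<or> c = -1" for c by (rule roe_mult_op[OF higson_bounded[OF hw[OF that]]])
  have fr: "?f \<in> roe" by (rule roe_mult_op[OF higson_bounded[OF f]])
  have meq: "?m c = op_add (op_scale (1/2) ident) (op_scale (of_real (c / (4 * M))) ?f)" for c
    unfolding ident_eq_mult_op op_scale_mult_op op_add_mult_op by (simp add: w_def v_def)
  have val: "\<psi> (?m c \<circ> b) = \<psi> b / 2 + of_real (c / (4 * M)) * \<psi> (?f \<circ> b)" if "b \<in> roe" for b c
    unfolding meq comp_op_add_left comp_op_scale_left using that fr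
    by (simp add: comp_ident roe_bop qstate_add[OF q] qstate_scale[OF q] roe_op_scale roe_comp[OF u])
  have val1: "\<psi> (?m c) = 1/2 + of_real (c / (4 * M)) * \<psi> ?f" for c
    using val[OF roe_ident, of c] fr by (simp add: comp_ident(1) roe_bop qstate_ident[OF q] meq bop_op_add bop_op_scale ident_bop)
  \<comment> \<open>The pointwise lower bound passes to the state. Used for both signs, it puts the
    mixing coefficient strictly between 0 and 1.\<close>
  have quarter: "\<psi> (?m c) \<in> \<real>" "Re (\<psi> (?m c)) \<ge> 1/4" if c: "c = 1 \<or> c = -1" for c
  proof -
    have bv: "bounded (range (\<lambda>x. v c x - 1/4))"
    proof (rule boundedI)
      show "norm z \<le> 1" if "z \<in> range (\<lambda>x. v c x - 1/4)" for z
      proof -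
        obtain x where "z = v c x - 1/4" using \<open>z \<in> _\<close> by blast
        then show ?thesis using v[OF c, of x] by simp
      qed
    qed
    have "mult_op (\<lambda>x. of_real (v c x - 1/4)) = op_sub (?m c) (op_scale (1/4) ident)"
      unfolding ident_eq_mult_op op_scale_mult_op op_sub_mult_op by (simp add: w_def)
    then have "\<psi> (mult_op (\<lambda>x. of_real (v c x - 1/4))) = \<psi> (?m c) - 1/4"
      using mr[OF c] by (simp add: qstate_sub[OF q] qstate_scale[OF q] roe_op_scale roe_ident qstate_ident[OF q])
    then have "\<psi> (?m c) - 1/4 \<in> \<real>" "Re (\<psi> (?m c) - 1/4) \<ge> 0"
      using qstate_mult_op_nonneg[OF q bv] v(1)[OF c] by auto
    then show "\<psi> (?m c) \<in> \<real>" "Re (\<psi> (?m c)) \<ge> 1/4"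
      by (auto simp: complex_is_Real_iff)
  qed
  define s where "s = Re (\<psi> (?m 1))"
  have s1: "\<psi> (?m 1) = of_real s" unfolding s_def using quarter(1)[of 1] by simp
  have s2: "\<psi> (?m (-1)) = of_real (1 - s)"
  proof -
    have "\<psi> (?m (-1)) + \<psi> (?m 1) = 1" using val1[of 1] val1[of "-1"] by simp
    then show ?thesis unfolding s1 by (simp add: eq_diff_eq)
  qed
  have s: "0 < s" "s < 1" using quarter(2)[of 1] quarter(2)[of "-1"] s1 s2 by auto
  have "kms h \<beta> (reweight \<psi> (w c))" if "c = 1 \<or> c = -1" for c
    by (rule kms_reweight[OF u k hg[OF that] hw[OF that] sq[OF that]]) (use quarter(2)[OF that] in auto)
  moreover have "\<psi> b = of_real s * reweight \<psi> (w 1) b + of_real (1 - s) * reweight \<psi> (w (-1)) b" if "b \<in> roe" for b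
    unfolding reweight_def s1 s2 using s val[OF that, of 1] val[OF that, of "-1"] by simp
  ultimately have "reweight \<psi> (w 1) a = \<psi> a"
    using e s a unfolding extreme_kms_def by blast
  then have "\<psi> (?m 1 \<circ> a) = \<psi> (?m 1) * \<psi> a"
    unfolding reweight_def s1 using s by (simp add: field_simps)
  then show ?thesis unfolding val[OF a] val1 using M(1) by (simp add: field_simps)
qed

lemma extreme_kms_mult:
  fixes h :: "'a::metric_space \<Rightarrow> real"
  assumes u: "ulf TYPE('a)" and e: "extreme_kms h \<beta> \<psi>" and f: "higson f" and a: "a \<in> roe"
  shows "\<psi> (mult_op f \<circ> a) = \<psi> (mult_op f) * \<psi> a"
proof -
  have q: "qstate \<psi>" using e by (simp add: extreme_kms_def kms_def)
  let ?R = "mult_op (\<lambda>x. complex_of_real (Re (f x)))" and ?I = "mult_op (\<lambda>x. complex_of_real (Im (f x)))"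
  have h: "higson (\<lambda>x. complex_of_real (Re (f x)))" "higson (\<lambda>x. complex_of_real (Im (f x)))"
    by (rule higson_lipschitz[OF f, of 1];
        simp add: of_real_diff[symmetric] minus_complex.simps[symmetric] abs_Re_le_cmod abs_Im_le_cmod del: of_real_diff minus_complex.simps)+
  note r = h[THEN higson_bounded, THEN roe_mult_op]
  have eq: "mult_op f = op_add ?R (op_scale \<i> ?I)"
    unfolding op_scale_mult_op op_add_mult_op by (simp add: complex_eq[symmetric])
  show ?thesis unfolding eq comp_op_add_left comp_op_scale_left using r a
    by (simp add: qstate_add[OF q] qstate_scale[OF q] roe_op_scale roe_comp[OF u]
        extreme_kms_mult_real[OF u e h(1) a] extreme_kms_mult_real[OF u e h(2) a] algebra_simps)
qed

lemma extreme_kms_character: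
  fixes h :: "'a::metric_space \<Rightarrow> real"
  assumes u: "ulf TYPE('a)" and e: "extreme_kms h \<beta> \<psi>" and Cl: "unital_sub_Cnu Cl"
  shows "character Cl (\<lambda>f. \<psi> (mult_op f))"
proof -
  have q: "qstate \<psi>" using e by (simp add: extreme_kms_def kms_def)
  have h: "higson f" if "f \<in> Cl" for f using Cl that by (simp add: unital_sub_Cnu_def)
  note r = roe_mult_op[OF higson_bounded[OF h]]
  show ?thesis
    unfolding character_def
  proof (intro conjI ballI allI impI)
    show "\<psi> (mult_op f) = 0" if "c0 f" for f by (rule qstate_compact[OF q c0_imp_compact[OF that]])
    show "\<psi> (mult_op (\<lambda>x. f x + g x)) = \<psi> (mult_op f) + \<psi> (mult_op g)" if "f \<in> Cl" "g \<in> Cl" for f g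
      using qstate_add[OF q r[OF that(1)] r[OF that(2)]] by (simp add: op_add_mult_op)
    show "\<psi> (mult_op (\<lambda>x. f x * g x)) = \<psi> (mult_op f) * \<psi> (mult_op g)" if "f \<in> Cl" "g \<in> Cl" for f g
      using extreme_kms_mult[OF u e h[OF that(1)] r[OF that(2)]]
      by (simp add: mult_op_comp[OF higson_bounded[OF h[OF that(2)]]])
    show "\<psi> (mult_op (\<lambda>x. c * f x)) = c * \<psi> (mult_op f)" if "f \<in> Cl" for f c
      using qstate_scale[OF q r[OF that]] by (simp add: op_scale_mult_op)
    show "\<psi> (mult_op (\<lambda>_. 1)) = 1" using qstate_ident[OF q] by (simp add: ident_eq_mult_op)
  qed
qed

subsection \<open>Extreme points of compact faces\<close>

text \<open>The extremality condition for a subset; on a singleton it says that the point is an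
  extreme point of \<open>K\<close>. Points are functions, so that the product topology is
  available.\<close>

definition convex_face :: "('i \<Rightarrow> complex) set \<Rightarrow> ('i \<Rightarrow> complex) set \<Rightarrow> bool" where
  "convex_face K E \<longleftrightarrow> E \<subseteq> K \<and>
     (\<forall>p\<in>K. \<forall>q\<in>K. \<forall>s::real. 0 < s \<and> s < 1 \<and> (\<lambda>a. of_real s * p a + of_real (1 - s) * q a) \<in> E \<longrightarrow> p \<in> E \<and> q \<in> E)"

text \<open>A proper average of two numbers that are at most \<open>t\<close> equals
  \<open>t\<close> only if both do.\<close>

lemma convex_face_maximizers:
  assumes E: "convex_face K E" and m: "\<And>p. p \<in> E \<Longrightarrow> Re (c * p a) \<le> t"
  shows "convex_face K {p \<in> E. Re (c * p a) = t}"
proof -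
  have "p \<in> E \<and> q \<in> E \<and> Re (c * p a) = t \<and> Re (c * q a) = t"
    if "p \<in> K" "q \<in> K" "0 < s" "s < 1" and r: "(\<lambda>a. of_real s * p a + of_real (1 - s) * q a) \<in> E"
      "Re (c * (of_real s * p a + of_real (1 - s) * q a)) = t" for p q s
  proof -
    have pq: "p \<in> E" "q \<in> E" using E that unfolding convex_face_def by blast+
    have "s * Re (c * p a) + (1 - s) * Re (c * q a) = t" using r(2) by (simp add: algebra_simps)
    then have e: "s * (t - Re (c * p a)) + (1 - s) * (t - Re (c * q a)) = 0" by (simp add: algebra_simps)
    have "s * (t - Re (c * p a)) \<ge> 0" "(1 - s) * (t - Re (c * q a)) \<ge> 0"
      using m[OF pq(1)] m[OF pq(2)] that by auto
    with e have "s * (t - Re (c * p a)) = 0" "(1 - s) * (t - Re (c * q a)) = 0" by linarith+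
    then show ?thesis using pq that by simp
  qed
  then show ?thesis using E unfolding convex_face_def by blast
qed

text \<open>The Krein--Milman argument: a minimal compact face is a single point, since every coordinate
  attains its maximum on a smaller compact face.\<close>
lemma compact_face_has_extreme_point:
  fixes K L :: "('i \<Rightarrow> complex) set"
  assumes L: "compact L" "closed L" "L \<noteq> {}" "convex_face K L"
  shows "\<exists>p\<in>L. convex_face K {p}"
proof -
  define A where "A = {E. closed E \<and> E \<noteq> {} \<and> convex_face K E \<and> E \<subseteq> L}"
  have "\<exists>m\<in>A. \<forall>a\<in>A. m \<supseteq> a \<longrightarrow> a = m"
  proof (rule predicate_Zorn)
    show "partial_order_on A (relation_of (\<supseteq>) A)"
      by (rule partial_order_on_relation_ofI) auto
    fix C assume C: "C \<in> Chains (relation_of (\<supseteq>) A)"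
    then have CA: "C \<subseteq> A" and chain: "\<And>S T. S \<in> C \<Longrightarrow> T \<in> C \<Longrightarrow> S \<subseteq> T \<or> T \<subseteq> S"
      unfolding Chains_def relation_of_def by auto
    show "\<exists>u\<in>A. \<forall>a\<in>C. a \<supseteq> u"
    proof (cases "C = {}")
      case True
      then show ?thesis using L by (auto simp: A_def)
    next
      case False
      \<comment> \<open>Finitely many members of a chain have a smallest one, which is nonempty;
        this feeds the finite intersection property.\<close>
      have fin: "\<exists>S\<in>C. S \<subseteq> \<Inter>F" if "finite F" "F \<noteq> {}" "F \<subseteq> C" for F
        using that
      proof (induction F rule: finite_ne_induct)
        case (insert S F)
        then obtain T where T: "T \<in> C" "T \<subseteq> \<Inter>F" by auto
        have S: "S \<in> C" using insert.prems by simp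
        from chain[OF S T(1)] show ?case
        proof
          assume "S \<subseteq> T"
          then have "S \<subseteq> \<Inter>(insert S F)" using T(2) by simp
          then show ?case using S by blast
        next
          assume "T \<subseteq> S"
          then have "T \<subseteq> \<Inter>(insert S F)" using T(2) by simp
          then show ?case using T(1) by blast
        qed
      qed auto
      have cl: "closed T" if "T \<in> C" for T using that CA by (auto simp: A_def)
      have ne: "L \<inter> \<Inter>C \<noteq> {}"
      proof (rule compact_imp_fip[OF L(1) cl])
        fix F assume F: "finite F" "F \<subseteq> C"
        show "L \<inter> \<Inter>F \<noteq> {}"
        proof (cases "F = {}")
          case False
          then obtain S where "S \<in> C" "S \<subseteq> \<Inter>F" using fin F by blast
          moreover have "S \<noteq> {}" "S \<subseteq> L" using \<open>S \<in> C\<close> CA by (auto simp: A_def)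
          ultimately show ?thesis by blast
        qed (use L in auto)
      qed
      obtain S where S: "S \<in> C" using False by blast
      have "closed (\<Inter>C)" using cl by (intro closed_Inter) auto
      moreover have "L \<inter> \<Inter>C = \<Inter>C" using S CA by (auto simp: A_def)
      moreover have "convex_face K (\<Inter>C)"
        using CA S unfolding A_def convex_face_def by blast
      moreover have "\<Inter>C \<subseteq> L" using S CA by (auto simp: A_def)
      ultimately have "\<Inter>C \<in> A" using ne unfolding A_def by simp
      then show ?thesis by blast
    qed
  qed
  then obtain E where E: "E \<in> A" and min: "\<And>E'. E' \<in> A \<Longrightarrow> E' \<subseteq> E \<Longrightarrow> E' = E" by blast
  have Ec: "closed E" "E \<noteq> {}" "convex_face K E" "E \<subseteq> L" using E by (auto simp: A_def)
  have "compact E" using compact_Int_closed[OF L(1) Ec(1)] Ec(4) by (simp add: inf.absorb2)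
  have const: "Re (c * p a) = Re (c * q a)" if "p \<in> E" "q \<in> E" for c a p q
  proof -
    have cont: "continuous_on S (\<lambda>p :: 'i \<Rightarrow> complex. Re (c * p a))" for S
      by (intro continuous_intros continuous_on_subset[OF continuous_on_product_coordinates]) auto
    obtain r where r: "r \<in> E" "\<And>p. p \<in> E \<Longrightarrow> Re (c * p a) \<le> Re (c * r a)"
      using continuous_attains_sup[OF \<open>compact E\<close> Ec(2) cont] by blast
    let ?E = "{p \<in> E. Re (c * p a) = Re (c * r a)}"
    have "closed {p :: 'i \<Rightarrow> complex. Re (c * p a) = Re (c * r a)}"
      by (intro closed_Collect_eq cont) simp
    then have "closed ?E" using closed_Int[OF Ec(1)] by (simp add: Collect_conj_eq)
    moreover have "convex_face K ?E" by (rule convex_face_maximizers[OF Ec(3) r(2)])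
    ultimately have "?E \<in> A" using r(1) Ec(4) by (auto simp: A_def)
    then have "?E = E" using min by blast
    then have "p \<in> ?E" "q \<in> ?E" using that by simp_all
    then show ?thesis by simp
  qed
  obtain p where p: "p \<in> E" using Ec(2) by blast
  have "q = p" if "q \<in> E" for q
  proof
    \<comment> \<open>The factor 1 compares real parts and the factor -\<i> compares imaginary
      parts.\<close>
    fix a show "q a = p a"
      using const[OF that p, of 1 a] const[OF that p, of "-\<i>" a] by (simp add: complex_eq_iff)
  qed
  then have "E = {p}" using p by blast
  then show ?thesis using Ec(3,4) by blast
qed

subsection \<open>The compact set of KMS states\<close>

text \<open>Fixing the values outside \<open>roe\<close> makes states that agree on
  \<open>roe\<close> equal as functions and keeps those coordinates bounded.\<close>

definition kms_set :: "('a::metric_space \<Rightarrow> real) \<Rightarrow> real \<Rightarrow> ('a op \<Rightarrow> complex) set" where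
  "kms_set h \<beta> = {\<psi>. kms h \<beta> \<psi> \<and> (\<forall>a. a \<notin> roe \<longrightarrow> \<psi> a = 0)}"

definition restrict_roe :: "(('a::metric_space) op \<Rightarrow> complex) \<Rightarrow> 'a op \<Rightarrow> complex" where
  "restrict_roe \<psi> a = (if a \<in> roe then \<psi> a else 0)"

text \<open>All arguments in the algebraic conditions stay in \<open>roe\<close>, including the
  values of \<open>F\<close> by \<open>analytic_lift\<close>; a compact operator receives 0 in
  either case.\<close>

lemma restrict_roe_kms:
  fixes h :: "'a::metric_space \<Rightarrow> real"
  assumes u: "ulf TYPE('a)" and k: "kms h \<beta> \<psi>"
  shows "restrict_roe \<psi> \<in> kms_set h \<beta>"
proof -
  have q: "qstate \<psi>" using k by (simp add: kms_def)
  have "qstate (restrict_roe \<psi>)"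
    using q unfolding qstate_def restrict_roe_def
    by (simp add: roe_op_add roe_op_scale roe_comp[OF u] roe_adj roe_ident)
  moreover have "restrict_roe \<psi> (a \<circ> F (\<i> * of_real \<beta>)) = restrict_roe \<psi> (b \<circ> a)"
    if "a \<in> roe" "b \<in> roe" "analytic_lift h b F" for a b F
  proof -
    have "F z \<in> roe" for z using that(3) by (simp add: analytic_lift_def)
    then show ?thesis using k that by (simp add: restrict_roe_def roe_comp[OF u] kms_def)
  qed
  ultimately show ?thesis by (simp add: kms_set_def kms_def restrict_roe_def)
qed

lemma closed_Collect_const_imp: "(P \<Longrightarrow> closed {x. Q x}) \<Longrightarrow> closed {x. P \<longrightarrow> Q x}"
  by (cases P) auto

text \<open>For fixed operators each clause compares finitely many coordinates of the state. The
  premise \<open>analytic_lift\<close> does not mention the state, so it acts as a constant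
  condition.\<close>

lemma closed_kms_set: "closed (kms_set h \<beta>)"
  unfolding kms_set_def kms_def qstate_def Ball_def complex_is_Real_iff
  by (intro closed_Collect_conj closed_Collect_all closed_Collect_const_imp closed_Collect_eq
      closed_Collect_le continuous_intros continuous_on_product_coordinates)

text \<open>Tychonoff for the product of discs whose radii come from
  \<open>qstate_bound\<close>.\<close>

lemma compact_kms_set:
  fixes h :: "'a::metric_space \<Rightarrow> real"
  assumes u: "ulf TYPE('a)" shows "compact (kms_set h \<beta>)"
proof -
  define B where "B = (\<lambda>a :: 'a op. if a \<in> roe then 2 * (opnorm a + 1) else 0)"
  moreover have "compact (PiE UNIV (\<lambda>a. cball 0 (B a)) :: ('a op \<Rightarrow> complex) set)"
  proof -
    have "compactin (product_topology (\<lambda>_. euclidean) UNIV)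
        (PiE UNIV (\<lambda>a. cball 0 (B a)) :: ('a op \<Rightarrow> complex) set)"
      unfolding compactin_PiE by auto
    then show ?thesis by (simp add: euclidean_product_topology)
  qed
  moreover have "kms_set h \<beta> \<subseteq> PiE UNIV (\<lambda>a. cball 0 (B a))"
    using qstate_bound[OF u] by (auto simp: kms_set_def kms_def B_def)
  ultimately show ?thesis
    using compact_Int_closed[OF _ closed_kms_set] by (metis inf.absorb2)
qed

subsection \<open>KMS states extending a character\<close>

context
  fixes Cl :: "('a::metric_space) vec set"
  assumes Cl: "unital_sub_Cnu Cl"
begin

section \<open>Functional calculus in the subalgebra\<close>

lemma Cl_add: "f \<in> Cl \<Longrightarrow> g \<in> Cl \<Longrightarrow> (\<lambda>x. f x + g x) \<in> Cl"
  and Cl_mult: "f \<in> Cl \<Longrightarrow> g \<in> Cl \<Longrightarrow> (\<lambda>x. f x * g x) \<in> Cl"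
  and Cl_scale: "f \<in> Cl \<Longrightarrow> (\<lambda>x. c * f x) \<in> Cl"
  and Cl_cnj: "f \<in> Cl \<Longrightarrow> (\<lambda>x. cnj (f x)) \<in> Cl"
  and Cl_one: "(\<lambda>_. 1) \<in> Cl"
  and Cl_c0: "c0 f \<Longrightarrow> f \<in> Cl"
  and Cl_higson: "f \<in> Cl \<Longrightarrow> higson f"
  and Cl_closed: "bounded (range f) \<Longrightarrow> (\<And>\<epsilon>. \<epsilon> > 0 \<Longrightarrow> \<exists>g\<in>Cl. \<forall>x. cmod (f x - g x) < \<epsilon>) \<Longrightarrow> f \<in> Cl"
  using Cl by (simp_all add: unital_sub_Cnu_def)

lemma Cl_const: "(\<lambda>_. c) \<in> Cl"
  using Cl_scale[OF Cl_one, of c] by simp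

lemma Cl_diff: "f \<in> Cl \<Longrightarrow> g \<in> Cl \<Longrightarrow> (\<lambda>x. f x - g x) \<in> Cl"
  using Cl_add[OF _ Cl_scale[of g "-1"], of f] by simp

lemma Cl_power: "f \<in> Cl \<Longrightarrow> (\<lambda>x. f x ^ n) \<in> Cl"
  by (induction n) (auto intro: Cl_one Cl_mult)

lemma Cl_sum: "(\<And>i. i \<in> I \<Longrightarrow> f i \<in> Cl) \<Longrightarrow> (\<lambda>x. \<Sum>i\<in>I. f i x) \<in> Cl"
  by (induction I rule: infinite_finite_induct) (auto intro: Cl_const Cl_add)

text \<open>Continuous functional calculus: \<open>Cl\<close> is closed under polynomials and
  uniform limits, and Bernstein polynomials approximate \<open>v\<close>. Rescaling by
  \<open>M\<close> carries {0..M} to the unit interval on which they live.\<close>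

lemma Cl_continuous:
  fixes g :: "'a \<Rightarrow> real"
  assumes g: "(\<lambda>x. of_real (g x)) \<in> Cl" "\<And>x. 0 \<le> g x" "\<And>x. g x \<le> M" "M > 0"
    and v: "continuous_on {0..M} v"
  shows "(\<lambda>x. of_real (v (g x))) \<in> Cl"
proof (rule Cl_closed)
  have "bounded (v ` {0..M})" by (intro compact_imp_bounded compact_continuous_image v) simp
  then have "bounded (of_real ` v ` {0..M} :: complex set)" by (simp add: bounded_iff)
  then show "bounded (range (\<lambda>x. complex_of_real (v (g x))))"
    by (rule bounded_subset) (use g in auto)
  fix \<epsilon> :: real assume e: "\<epsilon> > 0"
  have "continuous_on {0..1} (\<lambda>t. v (M * t))"
    by (rule continuous_on_compose2[OF v]) (use g(4) in \<open>auto intro!: continuous_intros simp: mult_left_le\<close>)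
  then obtain N where N: "\<And>n x. N \<le> n \<Longrightarrow> x \<in> {0..1} \<Longrightarrow>
      \<bar>v (M * x) - (\<Sum>k\<le>n. v (M * (k / n)) * Bernstein n k x)\<bar> < \<epsilon>"
    using Bernstein_Weierstrass[OF _ e] by blast
  define p where "p = (\<lambda>x. \<Sum>k\<le>N. v (M * (k / N)) * Bernstein N k (g x / M))"
  have "(\<lambda>x. complex_of_real (p x)) = (\<lambda>x. \<Sum>k\<le>N. of_real (v (M * (k / N)) * (N choose k)) *
      ((of_real (1 / M) * of_real (g x)) ^ k * (1 - of_real (1 / M) * of_real (g x)) ^ (N - k)))"
    by (simp add: p_def Bernstein_def mult.assoc)
  also have "\<dots> \<in> Cl"
    by (intro Cl_sum Cl_scale Cl_mult Cl_power Cl_diff Cl_one g(1))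
  finally have pCl: "(\<lambda>x. complex_of_real (p x)) \<in> Cl" .
  have "\<bar>v (g x) - p x\<bar> < \<epsilon>" for x
    using N[of N "g x / M"] g(2)[of x] g(3)[of x] g(4) by (simp add: p_def)
  then have "cmod (of_real (v (g x)) - of_real (p x)) < \<epsilon>" for x
    unfolding of_real_diff[symmetric] norm_of_real .
  then show "\<exists>f\<in>Cl. \<forall>x. cmod (of_real (v (g x)) - f x) < \<epsilon>" by (intro bexI[OF _ pCl] allI)
qed

text \<open>With \<open>k = max g \<epsilon> - g\<close> and \<open>w = 1 / max g \<epsilon>\<close> we have \<open>w (g + k) = 1\<close>, so \<open>k\<close> is not killed by the
  character and, by faithfulness, the state may be reweighted by \<open>k\<^sup>2\<close>, which lives on \<open>{g \<le> \<epsilon>}\<close>.\<close>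
lemma kms_concentrated:
  fixes h :: "'a \<Rightarrow> real" and g :: "'a \<Rightarrow> real"
  assumes u: "ulf TYPE('a)" and k: "kms h \<beta> \<phi>" and faith: "faithful_on Cl \<phi>"
    and chr: "character Cl chr"
    and g: "(\<lambda>x. of_real (g x)) \<in> Cl" "\<And>x. 0 \<le> g x" "chr (\<lambda>x. of_real (g x)) = 0" and e: "\<epsilon> > 0"
  shows "\<exists>\<psi>. kms h \<beta> \<psi> \<and> Re (\<psi> (mult_op (\<lambda>x. of_real (g x)))) \<le> \<epsilon>"
proof -
  have q: "qstate \<phi>" using k by (simp add: kms_def)
  obtain B where B: "\<And>x. \<bar>g x\<bar> \<le> B" using higson_bounded[OF Cl_higson[OF g(1)]] by (auto simp: bounded_iff)
  define M where "M = \<bar>B\<bar> + 1"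
  have M: "M > 0" "g x \<le> M" for x using B[of x] by (auto simp: M_def)
  define \<kappa> where "\<kappa> = (\<lambda>x. max (g x) \<epsilon> - g x)"
  define \<omega> where "\<omega> = (\<lambda>x. 1 / max (g x) \<epsilon>)"
  have \<kappa>: "(\<lambda>x. of_real (\<kappa> x)) \<in> Cl" unfolding \<kappa>_def
    by (rule Cl_continuous[OF g(1,2) M(2,1), of "\<lambda>t. max t \<epsilon> - t"]) (intro continuous_intros)
  have \<omega>: "(\<lambda>x. of_real (\<omega> x)) \<in> Cl" unfolding \<omega>_def
    by (rule Cl_continuous[OF g(1,2) M(2,1), of "\<lambda>t. 1 / max t \<epsilon>"])
       (intro continuous_intros, use e in \<open>auto simp: max_def\<close>)
  have chr_add: "chr (\<lambda>x. f x + f' x) = chr f + chr f'" and chr_mult: "chr (\<lambda>x. f x * f' x) = chr f * chr f'"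
    if "f \<in> Cl" "f' \<in> Cl" for f f' using chr that by (simp_all add: character_def)
  have "(\<lambda>x. complex_of_real (\<omega> x) * (of_real (g x) + of_real (\<kappa> x))) = (\<lambda>_. 1)"
  proof
    fix x
    have "\<omega> x * (g x + \<kappa> x) = 1" using e by (simp add: \<omega>_def \<kappa>_def)
    then show "complex_of_real (\<omega> x) * (of_real (g x) + of_real (\<kappa> x)) = 1"
      by (metis of_real_1 of_real_add of_real_mult)
  qed
  then have "chr (\<lambda>x. of_real (\<omega> x)) * (chr (\<lambda>x. of_real (g x)) + chr (\<lambda>x. of_real (\<kappa> x))) = 1"
    using chr_mult[OF \<omega> Cl_add[OF g(1) \<kappa>]] chr_add[OF g(1) \<kappa>] chr by (simp add: character_def)
  then have "chr (\<lambda>x. of_real (\<kappa> x)) \<noteq> 0" using g(3) by auto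
  then have nc: "\<not> c0 (\<lambda>x. complex_of_real (\<kappa> x))" using chr \<kappa> by (auto simp: character_def)
  note b\<kappa> = higson_bounded[OF Cl_higson[OF \<kappa>]]
  define w where "w = (\<lambda>x. complex_of_real ((\<kappa> x)\<^sup>2))"
  have wCl: "w \<in> Cl" using Cl_mult[OF \<kappa> \<kappa>] by (simp add: w_def power2_eq_square)
  note wr = roe_mult_op[OF higson_bounded[OF Cl_higson[OF wCl]]]
  note gr = roe_mult_op[OF higson_bounded[OF Cl_higson[OF g(1)]]]
  have "adj (mult_op (\<lambda>x. complex_of_real (\<kappa> x))) \<circ> mult_op (\<lambda>x. of_real (\<kappa> x)) = mult_op w"
    by (simp add: adj_mult_op[OF b\<kappa>] mult_op_comp[OF b\<kappa>] w_def power2_eq_square)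
  \<comment> \<open>Contrapositive of faithfulness: a compact multiplication operator would put its
    symbol in \<open>c0\<close>, where the character vanishes.\<close>
  then have nz: "\<phi> (mult_op w) \<noteq> 0"
    using faith \<kappa> nc compact_imp_c0 unfolding faithful_on_def by metis
  have \<kappa>B: "0 \<le> \<kappa> x" "\<kappa> x \<le> \<epsilon>" for x using g(2)[of x] e by (auto simp: \<kappa>_def max_def)
  have "bounded (range (\<lambda>x. (\<kappa> x)\<^sup>2))"
    unfolding bounded_iff using \<kappa>B by (auto intro!: exI[of _ "\<epsilon>\<^sup>2"] power_mono)
  then have "\<phi> (mult_op w) \<in> \<real>" "Re (\<phi> (mult_op w)) \<ge> 0"
    unfolding w_def by (rule qstate_mult_op_nonneg[OF q]; simp)+
  then obtain s where s: "\<phi> (mult_op w) = of_real s" "s > 0"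
    using nz by (metis Reals_cases Re_complex_of_real of_real_eq_0_iff less_le)
  have k': "kms h \<beta> (reweight \<phi> w)"
    by (rule kms_reweight[OF u k Cl_higson[OF \<kappa>] Cl_higson[OF wCl] w_def nz])
  then have q': "qstate (reweight \<phi> w)" by (simp add: kms_def)
  \<comment> \<open>The first factor vanishes where g exceeds \<epsilon>, so the product is
    nonnegative everywhere; positivity of the state on it says that the reweighted state of
    \<open>g\<close> is at most \<epsilon>.\<close>
  define m where "m = (\<lambda>x. (\<kappa> x)\<^sup>2 * (\<epsilon> - g x))"
  have m0: "m x \<ge> 0" for x using e by (cases "g x \<le> \<epsilon>") (auto simp: m_def \<kappa>_def)
  have "m x \<le> \<epsilon>\<^sup>2 * \<epsilon>" for x
  proof -
    have "m x \<le> (\<kappa> x)\<^sup>2 * \<epsilon>" unfolding m_def using g(2)[of x] by (intro mult_left_mono) auto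
    also have "\<dots> \<le> \<epsilon>\<^sup>2 * \<epsilon>" using e by (intro mult_right_mono power_mono \<kappa>B) auto
    finally show ?thesis .
  qed
  then have "bounded (range m)" unfolding bounded_iff using m0 by (auto intro!: exI[of _ "\<epsilon>\<^sup>2 * \<epsilon>"])
  then have m: "Re (\<phi> (mult_op (\<lambda>x. of_real (m x)))) \<ge> 0"
    by (rule qstate_mult_op_nonneg(2)[OF q]) (rule m0)
  let ?d = "op_sub (op_scale (of_real \<epsilon>) ident) (mult_op (\<lambda>x. complex_of_real (g x)))"
  have d: "?d = mult_op (\<lambda>x. of_real (\<epsilon> - g x))"
    unfolding ident_eq_mult_op op_scale_mult_op op_sub_mult_op by simp
  have "mult_op w \<circ> ?d = mult_op (\<lambda>x. of_real (m x))"
  proof -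
    have "bounded (range (\<lambda>x. complex_of_real (\<epsilon> - g x)))"
      using higson_bounded[OF Cl_higson[OF Cl_diff[OF Cl_const g(1)], of "of_real \<epsilon>"]] by simp
    then show ?thesis unfolding d by (subst mult_op_comp) (simp_all add: w_def m_def)
  qed
  then have "Re (reweight \<phi> w ?d) \<ge> 0"
    using m s by (simp add: reweight_def Re_divide_of_real)
  then have "Re (reweight \<phi> w (mult_op (\<lambda>x. of_real (g x)))) \<le> \<epsilon>"
    by (simp add: qstate_sub[OF q'] qstate_scale[OF q'] qstate_ident[OF q'] roe_op_scale roe_ident gr)
  then show ?thesis using k' by blast
qed

text \<open>The sum of the squares |f|^2. Multiplicativity makes the character vanish at f times its
  conjugate, whatever its value at the conjugate. Finitely many constraints are thus reduced to one
  nonnegative function.\<close>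

lemma exists_common_majorant:
  assumes chr: "character Cl chr" and I: "finite I" "\<And>f. f \<in> I \<Longrightarrow> f \<in> Cl \<and> chr f = 0"
  shows "\<exists>g. (\<lambda>x. of_real (g x)) \<in> Cl \<and> chr (\<lambda>x. of_real (g x)) = 0 \<and> (\<forall>x. 0 \<le> g x) \<and>
    (\<forall>f\<in>I. \<forall>x. (cmod (f x))\<^sup>2 \<le> g x)"
  using I
proof (induction I rule: finite_induct)
  case empty
  have z: "c0 (\<lambda>_. 0)" by (simp add: c0_def)
  then have "chr (\<lambda>_. 0) = 0" using chr Cl_c0[OF z] unfolding character_def by blast
  then show ?case using Cl_c0[OF z] by (intro exI[of _ "\<lambda>_. 0"]) simp
next
  case (insert f I)
  then obtain g where g: "(\<lambda>x. of_real (g x)) \<in> Cl" "chr (\<lambda>x. of_real (g x)) = 0" "\<And>x. 0 \<le> g x"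
    "\<And>f x. f \<in> I \<Longrightarrow> (cmod (f x))\<^sup>2 \<le> g x" by auto
  have f: "f \<in> Cl" "chr f = 0" using insert by auto
  let ?g = "\<lambda>x. g x + (cmod (f x))\<^sup>2"
  have eq: "(\<lambda>x. complex_of_real (?g x)) = (\<lambda>x. of_real (g x) + f x * cnj (f x))"
    by (simp only: complex_norm_square of_real_add)
  have ff: "(\<lambda>x. f x * cnj (f x)) \<in> Cl" by (intro Cl_mult Cl_cnj f)
  have "chr (\<lambda>x. f x * cnj (f x)) = chr f * chr (\<lambda>x. cnj (f x))"
    using chr f(1) Cl_cnj[OF f(1)] by (simp add: character_def)
  then have "chr (\<lambda>x. complex_of_real (?g x)) = 0"
    unfolding eq using chr g(1,2) ff f(2) by (simp add: character_def)
  moreover have "(\<lambda>x. complex_of_real (?g x)) \<in> Cl" unfolding eq by (intro Cl_add g ff)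
  moreover have "(cmod (f' x))\<^sup>2 \<le> ?g x" if "f' \<in> insert f I" for f' x
    using that g(3)[of x] g(4)[of f' x] by (auto intro: add_increasing2)
  ultimately show ?case using g(3) by (intro exI[of _ ?g]) auto
qed

lemma adj_mult_op_self:
  "f \<in> Cl \<Longrightarrow> adj (mult_op f) \<circ> mult_op f = mult_op (\<lambda>x. of_real ((cmod (f x))\<^sup>2))"
  by (simp add: adj_mult_op mult_op_comp higson_bounded Cl_higson complex_norm_square mult.commute
      del: of_real_power)

text \<open>The extreme point is found among faces of the whole set of KMS states that lie in
  \<open>L\<close>, so it is extreme among all KMS states and not merely inside
  \<open>L\<close>.\<close>

lemma exists_extreme_kms:
  fixes h :: "'a \<Rightarrow> real"
  assumes u: "ulf TYPE('a)" and k: "kms h \<beta> \<phi>" and faith: "faithful_on Cl \<phi>"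
    and chr: "character Cl chr"
  shows "\<exists>\<psi>. extreme_kms h \<beta> \<psi> \<and> (\<forall>f\<in>Cl. \<psi> (mult_op f) = chr f)"
proof -
  let ?K = "kms_set h \<beta>"
  define N where "N = {f \<in> Cl. chr f = 0}"
  define sq where "sq = (\<lambda>f :: 'a vec. adj (mult_op f) \<circ> mult_op f)"
  have r: "mult_op f \<in> roe" if "f \<in> Cl" for f by (rule roe_mult_op[OF higson_bounded[OF Cl_higson[OF that]]])
  have q: "qstate \<psi>" if "\<psi> \<in> ?K" for \<psi> using that by (simp add: kms_set_def kms_def)
  have pos: "\<psi> (sq f) \<in> \<real>" "Re (\<psi> (sq f)) \<ge> 0" if "\<psi> \<in> ?K" "f \<in> Cl" for \<psi> f
    unfolding sq_def using qstate_pos[OF q[OF that(1)] r[OF that(2)]] by auto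
  \<comment> \<open>The constraint is put on squares: their values are nonnegative, which makes
    \<open>L\<close> a face, and Cauchy-Schwarz recovers vanishing on the kernel itself.\<close>
  define L where "L = {\<psi> \<in> ?K. \<forall>f\<in>N. \<psi> (sq f) = 0}"
  \<comment> \<open>Approximate constraints, since reweighting only concentrates a state up to
    \<epsilon>; within \<open>?K\<close> their total intersection is the exact constraint.\<close>
  define S where "S = (\<lambda>(f, \<epsilon>). {\<psi>. Re (\<psi> (sq f)) \<le> \<epsilon>})"
  have S: "closed (S i)" for i
    by (cases i) (auto simp: S_def intro!: closed_Collect_le continuous_intros continuous_on_product_coordinates)
  have "?K \<inter> (\<Inter>i\<in>N \<times> {0<..}. S i) \<noteq> {}"
  proof (rule compact_imp_fip_image[OF compact_kms_set[OF u] S])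
    fix I assume I: "finite I" "I \<subseteq> N \<times> {0::real<..}"
    obtain g where g: "(\<lambda>x. of_real (g x)) \<in> Cl" "chr (\<lambda>x. of_real (g x)) = 0" "\<And>x. 0 \<le> g x"
      "\<And>f x. f \<in> fst ` I \<Longrightarrow> (cmod (f x))\<^sup>2 \<le> g x"
      using exists_common_majorant[OF chr, of "fst ` I"] I by (fastforce simp: N_def)
    \<comment> \<open>The element 1 keeps \<open>Min\<close> meaningful when \<open>I\<close> is
      empty.\<close>
    define \<epsilon> where "\<epsilon> = Min (insert 1 (snd ` I))"
    have "\<epsilon> > 0" unfolding \<epsilon>_def using I by (subst Min_gr_iff) auto
    then obtain \<psi> where \<psi>: "kms h \<beta> \<psi>" "Re (\<psi> (mult_op (\<lambda>x. of_real (g x)))) \<le> \<epsilon>"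
      using kms_concentrated[OF u k faith chr g(1,3,2)] by blast
    let ?p = "restrict_roe \<psi>"
    have p: "?p \<in> ?K" by (rule restrict_roe_kms[OF u \<psi>(1)])
    have "Re (?p (sq f)) \<le> \<delta>" if fd: "(f, \<delta>) \<in> I" for f \<delta>
    proof -
      have f: "f \<in> Cl" using I fd by (auto simp: N_def)
      let ?m = "\<lambda>x. g x - (cmod (f x))\<^sup>2"
      have m0: "?m x \<ge> 0" for x using g(4)[of f x] fd by (force intro: rev_image_eqI)
      have sqe: "sq f = mult_op (\<lambda>x. of_real ((cmod (f x))\<^sup>2))"
        unfolding sq_def by (rule adj_mult_op_self[OF f])
      have sqr: "sq f \<in> roe" unfolding sq_def by (intro roe_comp u roe_adj r f)
      obtain B where B: "\<And>x. \<bar>g x\<bar> \<le> B" using higson_bounded[OF Cl_higson[OF g(1)]] by (auto simp: bounded_iff)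
      have "bounded (range ?m)"
        unfolding bounded_iff
      proof (intro exI[of _ B] ballI)
        fix z assume "z \<in> range ?m"
        then obtain x where "z = ?m x" by blast
        moreover have "(cmod (f x))\<^sup>2 \<ge> 0" by simp
        then have "?m x \<le> B" using B[of x] by linarith
        ultimately show "norm z \<le> B" using m0[of x] by simp
      qed
      then have "Re (?p (mult_op (\<lambda>x. of_real (?m x)))) \<ge> 0"
        by (rule qstate_mult_op_nonneg(2)[OF q[OF p]]) (rule m0)
      moreover have "mult_op (\<lambda>x. of_real (?m x)) = op_sub (mult_op (\<lambda>x. of_real (g x))) (sq f)"
        unfolding sqe op_sub_mult_op by simp
      ultimately have "Re (?p (sq f)) \<le> Re (?p (mult_op (\<lambda>x. of_real (g x))))"
        by (simp add: qstate_sub[OF q[OF p] r[OF g(1)] sqr])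
      also have "\<dots> \<le> \<epsilon>" using \<psi>(2) r[OF g(1)] by (simp add: restrict_roe_def)
      also have "\<dots> \<le> \<delta>" unfolding \<epsilon>_def using I(1) fd by (intro Min_le) force+
      finally show ?thesis .
    qed
    then show "?K \<inter> (\<Inter>i\<in>I. S i) \<noteq> {}" using p by (auto simp: S_def)
  qed
  then obtain \<psi>0 where \<psi>0: "\<psi>0 \<in> ?K" "\<And>f \<epsilon>. f \<in> N \<Longrightarrow> \<epsilon> > 0 \<Longrightarrow> Re (\<psi>0 (sq f)) \<le> \<epsilon>"
    unfolding S_def by fastforce
  have "\<psi>0 (sq f) = 0" if f: "f \<in> N" for f
  proof -
    have fCl: "f \<in> Cl" using f by (simp add: N_def)
    have "Re (\<psi>0 (sq f)) \<le> 0" using \<psi>0(2)[OF f] by (intro field_le_epsilon[of _ 0]) simp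
    then show ?thesis using pos[OF \<psi>0(1) fCl] by (simp add: complex_is_Real_iff complex_eq_iff)
  qed
  then have "L \<noteq> {}" using \<psi>0(1) by (auto simp: L_def)
  moreover have "compact L" "closed L"
  proof -
    have "closed {\<psi> :: 'a op \<Rightarrow> complex. \<forall>f. f \<in> N \<longrightarrow> \<psi> (sq f) = 0}"
      by (intro closed_Collect_all closed_Collect_const_imp closed_Collect_eq continuous_on_product_coordinates continuous_intros)
    then show "compact L" "closed L"
      using compact_Int_closed[OF compact_kms_set[OF u, of h \<beta>]] closed_kms_set[of h \<beta>]
      by (simp_all add: L_def Ball_def Collect_conj_eq closed_Int)
  qed
  moreover have "convex_face ?K L"
  proof -
    have "p (sq f) = 0 \<and> p' (sq f) = 0"
      if p: "p \<in> ?K" "p' \<in> ?K" and s: "0 < s" "s < 1" and f: "f \<in> N"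
        and z: "of_real s * p (sq f) + of_real (1 - s) * p' (sq f) = 0" for p p' s f
    proof -
      have fCl: "f \<in> Cl" using f by (simp add: N_def)
      note P = pos[OF p(1) fCl] and P' = pos[OF p(2) fCl]
      have "s * Re (p (sq f)) + (1 - s) * Re (p' (sq f)) = 0"
        using arg_cong[OF z, of Re] by simp
      moreover have "s * Re (p (sq f)) \<ge> 0" "(1 - s) * Re (p' (sq f)) \<ge> 0" using P P' s by auto
      ultimately have "s * Re (p (sq f)) = 0" "(1 - s) * Re (p' (sq f)) = 0" by linarith+
      then show ?thesis using P P' s by (simp add: complex_is_Real_iff complex_eq_iff)
    qed
    then show ?thesis unfolding convex_face_def L_def by blast
  qed
  ultimately obtain \<psi> where \<psi>: "\<psi> \<in> L" "convex_face ?K {\<psi>}"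
    using compact_face_has_extreme_point by blast
  have \<psi>K: "\<psi> \<in> ?K" using \<psi>(1) by (simp add: L_def)
  have "\<psi> (mult_op f) = chr f" if f: "f \<in> Cl" for f
  proof -
    \<comment> \<open>Subtracting its value moves f into the kernel of the character; the form with
      a scaled constant matches the sum and scaling clauses of \<open>character\<close>.\<close>
    let ?f = "\<lambda>x. f x + chr f * (- 1)"
    have scale: "chr (\<lambda>x. c * f x) = c * chr f" if "f \<in> Cl" for c f
      using chr that by (simp add: character_def)
    have one: "chr (\<lambda>_. 1) = 1" using chr by (simp add: character_def)
    have c: "(\<lambda>_. -1) \<in> Cl" "chr (\<lambda>_. -1) = -1"
      using Cl_const scale[OF Cl_one, of "-1"] one by simp_all
    have "chr (\<lambda>x. chr f * (-1)) = chr f * chr (\<lambda>_. -1)"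
      by (rule scale[OF c(1)])
    moreover have "chr (\<lambda>x. f x + g x) = chr f + chr g" if "g \<in> Cl" for g
      using chr f that by (simp add: character_def)
    from this[OF Cl_scale[OF c(1)]] have "chr ?f = chr f + chr (\<lambda>x. chr f * (-1))" .
    ultimately have "chr ?f = 0" using c(2) by simp
    then have fN: "?f \<in> N" using Cl_add[OF f Cl_scale[OF c(1)]] by (simp add: N_def)
    then have fCl: "?f \<in> Cl" by (simp add: N_def)
    have "\<psi> (sq ?f) = 0" using \<psi>(1) fN by (simp add: L_def)
    then have "(cmod (\<psi> (mult_op ?f)))\<^sup>2 \<le> 0"
      using qstate_cauchy_schwarz[OF u q[OF \<psi>K] r[OF fCl]] by (simp add: sq_def)
    then have "\<psi> (mult_op ?f) = 0" by simp
    moreover have "mult_op ?f = op_add (mult_op f) (op_scale (- chr f) ident)"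
      unfolding ident_eq_mult_op op_scale_mult_op op_add_mult_op by simp
    ultimately show ?thesis
      using q[OF \<psi>K] r[OF f] by (simp add: qstate_add qstate_scale qstate_ident roe_op_scale roe_ident)
  qed
  moreover have "extreme_kms h \<beta> \<psi>"
    unfolding extreme_kms_def
  proof (intro conjI allI impI)
    show "kms h \<beta> \<psi>" using \<psi>K by (simp add: kms_set_def)
    fix \<psi>1 \<psi>2 :: "'a op \<Rightarrow> complex" and s :: real
    assume A: "kms h \<beta> \<psi>1 \<and> kms h \<beta> \<psi>2 \<and> 0 < s \<and> s < 1 \<and>
      (\<forall>a\<in>roe. \<psi> a = of_real s * \<psi>1 a + of_real (1 - s) * \<psi>2 a)"
    \<comment> \<open>The decomposition is given only on \<open>roe\<close>; restriction turns it
      into an equality of functions between members of \<open>?K\<close>, as the face condition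
      requires.\<close>
    then have "(\<lambda>a. of_real s * restrict_roe \<psi>1 a + of_real (1 - s) * restrict_roe \<psi>2 a) = \<psi>"
      using \<psi>K by (auto simp: kms_set_def restrict_roe_def fun_eq_iff)
    then have "restrict_roe \<psi>1 = \<psi> \<and> restrict_roe \<psi>2 = \<psi>"
      using \<psi>(2) restrict_roe_kms[OF u] A unfolding convex_face_def by blast
    then show "\<forall>a\<in>roe. \<psi>1 a = \<psi> a \<and> \<psi>2 a = \<psi> a"
      by (auto simp: restrict_roe_def fun_eq_iff split: if_splits)
  qed
  ultimately show ?thesis by blast
qed

end

theorem theorem4p4:
  fixes h :: "'a::metric_space \<Rightarrow> real" and \<beta> :: real and Cl :: "'a vec set"
  assumes "ulf TYPE('a)" and "coarse h" and "unital_sub_Cnu Cl"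
  shows "(\<forall>\<psi>. extreme_kms h \<beta> \<psi> \<longrightarrow>
            (\<exists>chr. character Cl chr \<and> (\<forall>f\<in>Cl. \<psi> (mult_op f) = chr f)))
     \<and> ((\<exists>\<psi>. kms h \<beta> \<psi> \<and> faithful_on Cl \<psi>) \<longrightarrow>
           (\<forall>chr. character Cl chr \<longrightarrow>
              (\<exists>\<psi>. extreme_kms h \<beta> \<psi> \<and> (\<forall>f\<in>Cl. \<psi> (mult_op f) = chr f))))"
  using extreme_kms_character[OF assms(1) _ assms(3)] exists_extreme_kms[OF assms(3,1)] by blast

end
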